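(* Let $\gamma>0$, $0<\mu<1$, $\alpha<0$, $\lambda>0$, let $j\ge1$ be an integer, and let $\{\mathbb{S}_n\}_{n\ge0}$ be the monic Meixner–Sobolev type orthogonal polynomials. Then, uniformly for $z$ in compact subsets of $\mathbb{C}$, $$\lim_{n\to\infty}\frac{(\mu-1)^n\,n}{\Gamma(n-z)}\,\mathbb{S}_n(z)=-\frac{z-\alpha}{(1-\mu)^{\gamma+z+1}\,\Gamma(-z)}.$$ The limit is independent of $\lambda$ and $j$.
   Context: $\Delta f(x)=f(x+1)-f(x)$ and $\Delta^j$ is its $j$-fold iterate. The monic Meixner–Sobolev type polynomials $\mathbb{S}_n$ ($\deg \mathbb{S}_n=n$, leading coefficient $1$) are the polynomials orthogonal with respect to the inner product on real polynomials $$\langle f,g\rangle_\lambda=\sum_{x=0}^{\infty}f(x)g(x)\,\frac{\mu^x\,\Gamma(\gamma+x)}{\Gamma(\gamma)\Gamma(x+1)}+\lambda\,\Delta^jf(\alpha)\,\Delta^jg(\alpha).$$ The functions $1/\Gamma(n-z)$ and $1/\Gamma(-z)$ are understood as entire functions of $z$. *)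

theory Defs
  imports "HOL-Analysis.Analysis" "HOL-Computational_Algebra.Polynomial"
begin

definition fwd_diff :: "(real \<Rightarrow> real) \<Rightarrow> real \<Rightarrow> real" where
  "fwd_diff f = (\<lambda>x. f (x + 1) - f x)"

definition meixner_weight :: "real \<Rightarrow> real \<Rightarrow> nat \<Rightarrow> real" where
  "meixner_weight \<gamma> \<mu> x = \<mu> ^ x * Gamma (\<gamma> + real x) / (Gamma \<gamma> * Gamma (real x + 1))"

text \<open>The series below converges absolutely for all polynomials when \<open>\<gamma> > 0\<close> and \<open>0 < \<mu> < 1\<close>.\<close>

definition sobolev_inner ::
  "real \<Rightarrow> real \<Rightarrow> real \<Rightarrow> real \<Rightarrow> nat \<Rightarrow> real poly \<Rightarrow> real poly \<Rightarrow> real" where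
  "sobolev_inner \<gamma> \<mu> \<alpha> lam j f g =
     (\<Sum>x. poly f (real x) * poly g (real x) * meixner_weight \<gamma> \<mu> x)
     + lam * (fwd_diff ^^ j) (poly f) \<alpha> * (fwd_diff ^^ j) (poly g) \<alpha>"

text \<open>For \<open>\<gamma> > 0\<close>, \<open>0 < \<mu> < 1\<close> and \<open>lam \<ge> 0\<close> the form above is an inner product, so it has
  exactly one sequence of monic orthogonal polynomials, singled out by this predicate.\<close>

definition monic_meixner_sobolev ::
  "real \<Rightarrow> real \<Rightarrow> real \<Rightarrow> real \<Rightarrow> nat \<Rightarrow> (nat \<Rightarrow> real poly) \<Rightarrow> bool" where
  "monic_meixner_sobolev \<gamma> \<mu> \<alpha> lam j S \<longleftrightarrow>
     (\<forall>n. degree (S n) = n \<and> lead_coeff (S n) = 1) \<and>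
     (\<forall>m n. m \<noteq> n \<longrightarrow> sobolev_inner \<gamma> \<mu> \<alpha> lam j (S m) (S n) = 0)"

end

theory Submission
  imports Defs "HOL-Computational_Algebra.Formal_Power_Series" "HOL-Real_Asymp.Real_Asymp"
begin

text \<open>
  The monic Meixner polynomials $M_n$ are orthogonal for the weight $w$ alone; write $\Delta^j M_n(\alpha) = D_n$
  and let $h_n$ be the squared norm of $M_n$. Adding the Sobolev term changes the form by a rank one
  perturbation, so
  $$S_n = M_n - \frac{D_n}{W_n} \sum_{i<n} \frac{D_i}{h_i} M_i, \qquad
    W_n = \frac1\lambda + \sum_{i<n} \frac{D_i^2}{h_i}.$$
  At a fixed point $z$ the two terms agree to leading order, so reading off the limit from this formula would
  take second-order asymptotics of both. This is avoided by eliminating the sum between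
  consecutive indices (lemma \<open>S_rec\<close>):
  $$S_{n+1} = M_{n+1} - \frac{D_{n+1}}{D_n} M_n + \frac{D_{n+1}}{D_n} \frac{W_n}{W_{n+1}} S_n.$$

  After normalisation, $T_n(z) = (\mu-1)^n n S_n(z) / \Gamma(n-z)$ satisfies $T_{n+1} = a_n T_n + b_n$ where, uniformly on
  compact sets, $a_n \to \mu$ and $b_n(z) \to (\alpha - z) Q(z)$. Since $|\mu| < 1$ the recurrence is a
  contraction and $T_n \to (\alpha - z) Q(z) / (1-\mu)$, which is the claim; the contraction principle is
  \<open>uniform_limit_affine_recurrence\<close>. Here $Q(z) = (1-\mu)^{-\gamma-z}/\Gamma(-z)$ is the Mehler-Heine limit of
  $q_n(z) = (\mu-1)^n M_n(z)/\Gamma(n-z)$. The number $\alpha - z$ is the difference between the growth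
  exponents of $\Gamma(n-z)$ and $\Gamma(n-\alpha)$. It survives unchanged because $q_n$ and the normalised $D_n$ not only
  converge but have increments $o(1/n)$, and because $D_n$ behaves like $(-1)^j M_n(\alpha)$: shifting the
  argument by one costs a factor $n$, so only the unshifted term of $\Delta^j$ counts. So $j$ enters only through a sign that cancels in
  $D_{n+1}/D_n$, and $\lambda$ only through a constant summand of the geometrically growing $W_n$; neither is visible
  in the limit.

  The Mehler-Heine limit is first obtained for $\mathrm{Re}\, z \le -1$ from the generating function
  $(1-s)^z (1-\mu s)^{-z-\gamma}$, where dominated convergence applies directly. The three-term recurrence turns
  convergence of $q_n$ into the $o(1/n)$ bound for its increments (\<open>uniform_limit_scaled_q_diff\<close>), and with this bound
  a difference equation in $z$ carries convergence from $z$ to $z+1$ (\<open>uniform_limit_q_shift\<close>); both steps are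
  again instances of the contraction principle. Orthogonality and the ratio $h_{n+1}/h_n$, which
  yields $W_n/W_{n+1} \to \mu$, follow from the three-term recurrence once every $M_n$ with $n \ge 1$ is known to be
  orthogonal to constants (\<open>L_M_Suc\<close>).
\<close>

section \<open>Uniform limits of sequences defined by affine recurrences\<close>

lemma uniform_limit_by_bound:
  fixes f :: "'b \<Rightarrow> 'a \<Rightarrow> 'c::real_normed_vector"
  assumes "\<forall>\<^sub>F n in F. \<forall>z\<in>K. norm (f n z - l z) \<le> g n" and "(g \<longlongrightarrow> 0) F"
  shows "uniform_limit K f l F"
proof (rule uniform_limitI)
  fix e :: real assume "e > 0"
  then have "\<forall>\<^sub>F n in F. g n < e" using assms(2) by (rule order_tendstoD(2)[rotated])
  with assms(1) show "\<forall>\<^sub>F n in F. \<forall>z\<in>K. dist (f n z) (l z) < e"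
    by eventually_elim (force simp: dist_norm)
qed

lemma uniform_limit_inverse_shift:
  fixes c :: "'a \<Rightarrow> complex"
  assumes "bounded (c ` K)"
  shows "uniform_limit K (\<lambda>n z. 1 / (of_nat n + c z)) (\<lambda>_. 0) sequentially"
proof -
  from assms obtain C where C: "\<And>z. z \<in> K \<Longrightarrow> norm (c z) \<le> C"
    by (auto simp: bounded_iff)
  show ?thesis
  proof (rule uniform_limit_by_bound)
    show "((\<lambda>n. 1 / (real n - C)) \<longlongrightarrow> 0) sequentially"
      by real_asymp
    show "\<forall>\<^sub>F n in sequentially. \<forall>z\<in>K. norm (1 / (of_nat n + c z) - 0) \<le> 1 / (real n - C)"
    proof (use eventually_gt_at_top[of "nat \<lceil>C\<rceil>"] in eventually_elim, safe)
      fix n z assume n: "n > nat \<lceil>C\<rceil>" and z: "z \<in> K"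
      have "norm (of_nat n + c z) \<ge> real n - norm (c z)"
        using norm_triangle_ineq4[of "of_nat n + c z" "c z"] by simp
      moreover have "real n > C" using n by linarith
      ultimately show "norm (1 / (of_nat n + c z) - 0) \<le> 1 / (real n - C)"
        using C[OF z] by (simp add: norm_divide frac_le)
    qed
  qed
qed

lemma uniform_limit_ratio_shift:
  fixes c c' :: "'a \<Rightarrow> complex"
  assumes "bounded (c ` K)" "bounded (c' ` K)"
  shows "uniform_limit K (\<lambda>n z. (of_nat n + c z) / (of_nat n + c' z)) (\<lambda>_. 1) sequentially"
proof -
  have "bounded ((\<lambda>z. c z - c' z) ` K)"
    using bounded_minus_comp[OF assms] .
  then have "uniform_limit K (\<lambda>n z. 1 + (c z - c' z) * (1 / (of_nat n + c' z))) (\<lambda>z. 1 + (c z - c' z) * 0) sequentially"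
    by (intro uniform_limit_add uniform_lim_mult uniform_limit_const
              uniform_limit_inverse_shift assms) (auto intro: finite_imp_bounded finite_subset[of _ "{0}"])
  moreover from assms(2) obtain C where C: "\<And>z. z \<in> K \<Longrightarrow> norm (c' z) \<le> C"
    by (auto simp: bounded_iff)
  have "\<forall>\<^sub>F n in sequentially. \<forall>z\<in>K. 1 + (c z - c' z) * (1 / (of_nat n + c' z)) = (of_nat n + c z) / (of_nat n + c' z)"
  proof (use eventually_gt_at_top[of "nat \<lceil>C\<rceil>"] in eventually_elim, safe)
    fix n z assume n: "n > nat \<lceil>C\<rceil>" and z: "z \<in> K"
    have "of_nat n + c' z \<noteq> 0"
    proof
      assume "of_nat n + c' z = 0"
      then have "c' z = - of_nat n" by (simp add: add_eq_0_iff)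
      then have "norm (c' z) = real n" by simp
      with C[OF z] n show False by linarith
    qed
    then show "1 + (c z - c' z) * (1 / (of_nat n + c' z)) = (of_nat n + c z) / (of_nat n + c' z)"
      by (simp add: field_simps)
  qed
  ultimately show ?thesis
    by (subst (asm) uniform_limit_cong) auto
qed

text \<open>
  Unrolling the inequality bounds $\|d_{N+k}\|$ by $r^k M$ plus a geometric series in the errors, which from $N$ on are
  uniformly small.
\<close>

lemma uniform_limit_contraction:
  fixes d :: "nat \<Rightarrow> 'a \<Rightarrow> 'b::real_normed_vector"
  assumes "0 \<le> r" "r < 1"
    and step: "\<forall>\<^sub>F n in sequentially. \<forall>z\<in>K. norm (d (Suc n) z) \<le> r * norm (d n z) + norm (e n z)"
    and e: "uniform_limit K e (\<lambda>_. 0) sequentially"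
    and bdd: "\<forall>\<^sub>F n in sequentially. bounded (d n ` K)"
  shows "uniform_limit K d (\<lambda>_. 0) sequentially"
proof (rule uniform_limitI)
  fix \<epsilon> :: real assume "\<epsilon> > 0"
  \<comment> \<open>Chosen so that the errors add up to at most $\eta/(1-r) = \epsilon/2$.\<close>
  define \<eta> where "\<eta> = \<epsilon> * (1 - r) / 2"
  have "\<eta> > 0" using \<open>\<epsilon> > 0\<close> \<open>r < 1\<close> by (simp add: \<eta>_def)
  from eventually_conj[OF step eventually_conj[OF bdd uniform_limitD[OF e this]]]
  have "\<forall>\<^sub>F n in sequentially. (\<forall>z\<in>K. norm (d (Suc n) z) \<le> r * norm (d n z) + \<eta>) \<and> bounded (d n ` K)"
    by eventually_elim force
  then obtain N where N: "\<And>n z. n \<ge> N \<Longrightarrow> z \<in> K \<Longrightarrow> norm (d (Suc n) z) \<le> r * norm (d n z) + \<eta>"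
    and bN: "bounded (d N ` K)"
    by (auto simp: eventually_sequentially)
  from bN obtain M where M: "\<And>z. z \<in> K \<Longrightarrow> norm (d N z) \<le> M"
    by (auto simp: bounded_iff)
  have bound: "norm (d (N + k) z) \<le> r ^ k * M + \<epsilon> / 2" if "z \<in> K" for k z
  proof (induction k)
    case 0 then show ?case using M[OF that] \<open>\<epsilon> > 0\<close> by simp
  next
    case (Suc k)
    have "norm (d (N + Suc k) z) \<le> r * (r ^ k * M + \<epsilon> / 2) + \<eta>"
      using N[of "N + k" z] that mult_left_mono[OF Suc \<open>0 \<le> r\<close>] by simp
    also have "\<dots> = r ^ Suc k * M + \<epsilon> / 2" by (simp add: \<eta>_def field_simps)
    finally show ?case .
  qed
  have "(\<lambda>k. r ^ k * M) \<longlonglongrightarrow> 0"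
    using tendsto_mult_right[OF LIMSEQ_power_zero[of r], of M] assms(1,2) by simp
  then have "\<forall>\<^sub>F k in sequentially. r ^ k * M < \<epsilon> / 2"
    using \<open>\<epsilon> > 0\<close> by (intro order_tendstoD(2)[of _ 0]) auto
  then obtain k0 where k0: "\<And>k. k \<ge> k0 \<Longrightarrow> r ^ k * M < \<epsilon> / 2"
    by (auto simp: eventually_sequentially)
  show "\<forall>\<^sub>F n in sequentially. \<forall>z\<in>K. dist (d n z) 0 < \<epsilon>"
    using eventually_ge_at_top[of "N + k0"]
  proof eventually_elim
    case (elim n)
    show ?case
      using bound[of _ "n - N"] k0[of "n - N"] elim by (force simp: dist_norm)
  qed
qed

text \<open>
  The only possible limit is the fixed point of $t \mapsto r t + B(z)$. The deviation $d_n$ from it satisfies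
  $d_{n+1} = a_n d_n + e_n$ with errors $e_n$ tending to $0$ uniformly, so the contraction lemma applies.
\<close>

lemma uniform_limit_affine_recurrence:
  fixes T a b :: "nat \<Rightarrow> 'a \<Rightarrow> 'b::real_normed_field"
  assumes a: "uniform_limit K a (\<lambda>_. r) sequentially" and "norm r < 1"
    and b: "uniform_limit K b B sequentially" and B: "bounded (B ` K)"
    and rec: "\<forall>\<^sub>F n in sequentially. \<forall>z\<in>K. T (Suc n) z = a n z * T n z + b n z"
    and bdd: "\<forall>\<^sub>F n in sequentially. bounded (T n ` K)"
  shows "uniform_limit K T (\<lambda>z. B z / (1 - r)) sequentially"
proof -
  define d where "d = (\<lambda>n z. T n z - B z / (1 - r))"
  define e where "e = (\<lambda>n z. (b n z - B z) + (a n z - r) * (B z / (1 - r)))"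
  have r1: "1 - r \<noteq> 0" using \<open>norm r < 1\<close> by auto
  have B': "bounded ((\<lambda>z. B z / (1 - r)) ` K)"
    using bounded_linear_image[OF B bounded_linear_mult_left[of "1 / (1 - r)"]]
    by (simp add: image_image)
  obtain s where s: "norm r < s" "s < 1" using dense[OF \<open>norm r < 1\<close>] by blast
  have e0: "uniform_limit K e (\<lambda>z. (B z - B z) + (r - r) * (B z / (1 - r))) sequentially"
    unfolding e_def
    by (intro uniform_limit_add uniform_limit_minus uniform_lim_mult uniform_limit_const a b B')
       (auto intro: finite_imp_bounded finite_subset[of _ "{0}"])
  have "\<forall>\<^sub>F n in sequentially. \<forall>z\<in>K. dist (a n z) r < s - norm r"
    using uniform_limitD[OF a, of "s - norm r"] s by simp
  then have "\<forall>\<^sub>F n in sequentially. \<forall>z\<in>K. norm (d (Suc n) z) \<le> s * norm (d n z) + norm (e n z)"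
    using rec
  proof eventually_elim
    case (elim n)
    show ?case
    proof
      fix z assume z: "z \<in> K"
      have "norm (a n z) \<le> s"
        using elim(1)[rule_format, OF z] norm_triangle_ineq2[of "a n z" r] by (simp add: dist_norm)
      have eq: "d (Suc n) z = a n z * d n z + e n z"
      proof -
        have "B z = (B z / (1 - r)) * (1 - r)" using r1 by simp
        then show ?thesis
          unfolding d_def e_def elim(2)[rule_format, OF z] by algebra
      qed
      have "norm (d (Suc n) z) \<le> norm (a n z) * norm (d n z) + norm (e n z)"
        unfolding eq by (metis norm_mult norm_triangle_ineq)
      also have "\<dots> \<le> s * norm (d n z) + norm (e n z)"
        using \<open>norm (a n z) \<le> s\<close> by (simp add: mult_right_mono)
      finally show "norm (d (Suc n) z) \<le> s * norm (d n z) + norm (e n z)" .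
    qed
  qed
  moreover have "\<forall>\<^sub>F n in sequentially. bounded (d n ` K)"
    using bdd by eventually_elim (use B' in \<open>auto simp: d_def intro!: bounded_minus_comp\<close>)
  ultimately have "uniform_limit K d (\<lambda>_. 0) sequentially"
    using e0 order.trans[OF norm_ge_zero[of r] less_imp_le[OF s(1)]] s(2)
    by (intro uniform_limit_contraction[where r = s and e = e and K = K and d = d]) simp_all
  from uniform_limit_add[OF this uniform_limit_const[where c = "\<lambda>z. B z / (1 - r)"]]
  show ?thesis by (simp add: d_def)
qed

section \<open>The series of $(1 - cX)^{-a}$\<close>

text \<open>
  This is the formal binomial series $(1 - cX)^{-a}$.
\<close>

definition rising_series :: "'a::field_char_0 \<Rightarrow> 'a \<Rightarrow> 'a fps" where
  "rising_series c a = Abs_fps (\<lambda>n. pochhammer a n / fact n * c ^ n)"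

lemma rising_series_deriv:
  "(1 - fps_const c * fps_X) * fps_deriv (rising_series c a) = fps_const (a * c) * rising_series c a"
proof (rule fps_ext)
  fix n
  have 1: "fps_nth ((1 - fps_const c * fps_X) * fps_deriv (rising_series c a)) n
      = of_nat (Suc n) * (pochhammer a (Suc n) / fact (Suc n) * c ^ Suc n)
        - of_nat n * (pochhammer a n / fact n * c ^ n) * c"
    by (cases n) (simp_all add: rising_series_def left_diff_distrib mult.assoc)
  have 2: "of_nat (Suc n) * (pochhammer a (Suc n) / fact (Suc n) * c ^ Suc n)
      = (a + of_nat n) * (pochhammer a n / fact n * c ^ n) * c"
    by (simp add: pochhammer_Suc field_simps del: of_nat_Suc)
  show "fps_nth ((1 - fps_const c * fps_X) * fps_deriv (rising_series c a)) n
      = fps_nth (fps_const (a * c) * rising_series c a) n"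
    unfolding 1 2 by (simp add: rising_series_def ring_distribs add_divide_distrib ac_simps)
qed

lemma rising_series_shift:
  "(1 - fps_const c * fps_X) * rising_series c (a + 1) = rising_series c a"
proof (rule fps_ext)
  fix n
  show "fps_nth ((1 - fps_const c * fps_X) * rising_series c (a + 1)) n = fps_nth (rising_series c a) n"
  proof (cases n)
    case (Suc m)
    have aux: "P * (a + s) / (s * f) - P / f = a * P / (s * f)" if "s \<noteq> 0" "f \<noteq> 0" for P f s :: 'a
      using that by (simp add: field_simps)
    have "a + 1 + of_nat m = a + of_nat (Suc m)" by simp
    then have 1: "pochhammer (a + 1) (Suc m) / fact (Suc m) - pochhammer (a + 1) m / fact m
        = pochhammer a (Suc m) / (fact (Suc m) :: 'a)"
      unfolding pochhammer_Suc[of "a + 1" m] pochhammer_rec[of a m] fact_Suc of_nat_fact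
      by (simp only: of_nat_mult of_nat_fact aux of_nat_neq_0 fact_nonzero not_False_eq_True)
    have "fps_nth ((1 - fps_const c * fps_X) * rising_series c (a + 1)) n
        = (pochhammer (a + 1) (Suc m) / fact (Suc m) - pochhammer (a + 1) m / fact m) * c ^ Suc m"
      by (simp add: Suc rising_series_def left_diff_distrib mult.assoc del: fact_Suc)
    then show ?thesis unfolding 1 by (simp add: Suc rising_series_def)
  next
    case 0
    then show ?thesis by (simp add: rising_series_def fps_mult_nth_0)
  qed
qed

section \<open>Meixner polynomials and their generating function\<close>

lemma map_poly_of_real_add:
  "map_poly complex_of_real (p + q) = map_poly complex_of_real p + map_poly complex_of_real q"
  by (rule poly_eqI) (simp add: coeff_map_poly)

lemma map_poly_of_real_diff:
  "map_poly complex_of_real (p - q) = map_poly complex_of_real p - map_poly complex_of_real q"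
  by (rule poly_eqI) (simp add: coeff_map_poly)

lemma map_poly_of_real_smult:
  "map_poly complex_of_real (smult a p) = smult (complex_of_real a) (map_poly complex_of_real p)"
  by (rule poly_eqI) (simp add: coeff_map_poly)

lemma poly_map_poly_of_real:
  "poly (map_poly complex_of_real p) (complex_of_real x) = complex_of_real (poly p x)"
  by (induction p) (simp_all add: map_poly_pCons)

lemma norm_pochhammer_le:
  fixes a :: complex
  assumes "norm a \<le> C"
  shows "norm (pochhammer a k) \<le> pochhammer C k"
proof (induction k)
  case (Suc k)
  have "norm (a + of_nat k) \<le> C + real k"
    using norm_triangle_ineq[of a "of_nat k"] assms by simp
  then show ?case
    using Suc order.trans[OF norm_ge_zero Suc] by (simp add: pochhammer_Suc norm_mult mult_mono)
qed simp

lemma gbinomial_uminus_power: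
  fixes a c :: "'a::field_char_0"
  shows "((- a) gchoose k) * (- c) ^ k = pochhammer a k / fact k * c ^ k"
proof -
  have s: "(- 1) ^ k * (- 1) ^ k = (1 :: 'a)" by (simp flip: power_mult_distrib)
  have "((- a) gchoose k) * (- c) ^ k = ((- 1) ^ k * (- 1) ^ k) * (pochhammer a k / fact k * c ^ k)"
    unfolding gbinomial_pochhammer power_minus[of c] minus_minus times_divide_eq_left times_divide_eq_right
    by (simp only: mult_ac)
  then show ?thesis unfolding s by simp
qed

lemma pochhammer_series_sums_complex:
  fixes a c :: complex
  assumes "norm c < 1"
  shows "(\<lambda>k. pochhammer a k / fact k * c ^ k) sums ((1 - c) powr (- a))"
  using gen_binomial_complex[of "- c" "- a"] assms unfolding gbinomial_uminus_power by simp

lemma pochhammer_series_summable_real: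
  fixes a c :: real
  assumes "\<bar>c\<bar> < 1"
  shows "summable (\<lambda>k. pochhammer a k / fact k * c ^ k)"
  using sums_summable[OF gen_binomial_real[of "- c" "- a"]] assms unfolding gbinomial_uminus_power by simp

lemma rGamma_shift:
  fixes z :: complex
  shows "rGamma (of_nat n - z) = (of_nat n - z) * rGamma (of_nat (Suc n) - z)"
  using rGamma_plus1[of "of_nat n - z"] by (simp add: algebra_simps)

locale meixner =
  fixes \<gamma> \<mu> :: real
  assumes gamma_pos: "\<gamma> > 0" and mu_pos: "0 < \<mu>" and mu_less_1: "\<mu> < 1"
begin

text \<open>
  The three-term recurrence is taken as the definition of the monic Meixner polynomials; its coefficients are
  fixed so that the generating function below comes out.
\<close>

definition diag_coeff :: "nat \<Rightarrow> real" where
  "diag_coeff n = ((1 + \<mu>) * n + \<mu> * \<gamma>) / (1 - \<mu>)"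

definition offdiag_coeff :: "nat \<Rightarrow> real" where
  "offdiag_coeff n = \<mu> * n * (real n - 1 + \<gamma>) / (1 - \<mu>)^2"

fun M :: "nat \<Rightarrow> real poly" where
  "M 0 = 1"
| "M (Suc 0) = [:- diag_coeff 0, 1:]"
| "M (Suc (Suc n)) = pCons 0 (M (Suc n)) - smult (diag_coeff (Suc n)) (M (Suc n))
     - smult (offdiag_coeff (Suc n)) (M n)"

abbreviation cM :: "nat \<Rightarrow> complex \<Rightarrow> complex" where
  "cM n \<equiv> poly (map_poly complex_of_real (M n))"

lemma cM_rec:
  "cM 0 z = 1" "cM (Suc 0) z = z - of_real (diag_coeff 0)"
  "cM (Suc (Suc n)) z = (z - of_real (diag_coeff (Suc n))) * cM (Suc n) z
     - of_real (offdiag_coeff (Suc n)) * cM n z"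
  by (simp_all add: map_poly_pCons map_poly_of_real_diff map_poly_of_real_smult left_diff_distrib)

text \<open>
  Multiplying by powers of $\mu - 1$ clears all denominators, so that later identities become polynomial.
\<close>

lemma cM_rec':
  "(of_real \<mu> - 1) * cM (Suc 0) z = of_real \<mu> * (z + of_real \<gamma>) - z"
  "(of_real \<mu> - 1)^2 * cM (Suc (Suc n)) z =
     (of_real \<mu> - 1) * ((1 + of_real \<mu>) * of_nat (Suc n) + of_real \<mu> * (z + of_real \<gamma>) - z) * cM (Suc n) z
     - of_real \<mu> * of_nat (Suc n) * (of_nat n + of_real \<gamma>) * cM n z"
proof -
  have 0: "(\<mu> - 1) * diag_coeff n = - ((1 + \<mu>) * n + \<mu> * \<gamma>)" for n
    using mu_less_1 by (simp add: diag_coeff_def field_simps)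
  have d: "(of_real \<mu> - 1) * complex_of_real (diag_coeff n) = - ((1 + of_real \<mu>) * of_nat n + of_real \<mu> * of_real \<gamma>)" for n
    using arg_cong[OF 0[of n], of complex_of_real] by simp
  have 1: "(\<mu> - 1)^2 * offdiag_coeff (Suc n) = \<mu> * Suc n * (real n + \<gamma>)" for n
    using mu_less_1 by (simp add: offdiag_coeff_def power2_commute[of 1])
  have e: "(of_real \<mu> - 1)^2 * complex_of_real (offdiag_coeff (Suc n)) = of_real \<mu> * of_nat (Suc n) * (of_nat n + of_real \<gamma>)" for n
    using arg_cong[OF 1[of n], of complex_of_real] by simp
  show "(of_real \<mu> - 1) * cM (Suc 0) z = of_real \<mu> * (z + of_real \<gamma>) - z"
    unfolding cM_rec using d[of 0] by (simp add: algebra_simps)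
  show "(of_real \<mu> - 1)^2 * cM (Suc (Suc n)) z =
     (of_real \<mu> - 1) * ((1 + of_real \<mu>) * of_nat (Suc n) + of_real \<mu> * (z + of_real \<gamma>) - z) * cM (Suc n) z
     - of_real \<mu> * of_nat (Suc n) * (of_nat n + of_real \<gamma>) * cM n z"
    unfolding cM_rec using d[of "Suc n"] e[of n] by algebra
qed

text \<open>
  The formal series $(1-s)^z (1-\mu s)^{-z-\gamma}$ in $s$; its $n$-th coefficient is $(\mu-1)^n M_n(z)/n!$.
\<close>

definition gen_fun :: "complex \<Rightarrow> complex fps" where
  "gen_fun z = rising_series 1 (- z) * rising_series (of_real \<mu>) (z + of_real \<gamma>)"

lemma gen_fun_shift:
  "(1 - fps_const (of_real \<mu>) * fps_X) * gen_fun (z + 1) = (1 - fps_X) * gen_fun z"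
proof -
  have 1: "(1 - fps_X) * rising_series 1 (- z) = rising_series 1 (- (z + 1))"
    using rising_series_shift[of "1::complex" "- (z + 1)"] by simp
  have 2: "(1 - fps_const (of_real \<mu>) * fps_X) * rising_series (of_real \<mu>) (z + 1 + of_real \<gamma>)
      = rising_series (complex_of_real \<mu>) (z + of_real \<gamma>)"
    using rising_series_shift[of "complex_of_real \<mu>" "z + of_real \<gamma>"] by (simp add: ac_simps)
  show ?thesis
    unfolding gen_fun_def mult.left_commute[of _ "rising_series 1 (- (z + 1))"] 2
    unfolding 1[symmetric] by (rule mult.assoc)
qed

lemma gen_fun_deriv:
  "(1 - fps_X) * (1 - fps_const (of_real \<mu>) * fps_X) * fps_deriv (gen_fun z)
    = (fps_const (of_real \<mu> * (z + of_real \<gamma>) - z) - fps_const (of_real \<mu> * of_real \<gamma>) * fps_X) * gen_fun z"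
proof -
  let ?A = "rising_series 1 (- z)" and ?B = "rising_series (complex_of_real \<mu>) (z + of_real \<gamma>)"
  let ?X = "fps_X :: complex fps" and ?m = "fps_const (complex_of_real \<mu>)"
  have A: "(1 - ?X) * fps_deriv ?A = fps_const (- z) * ?A"
    using rising_series_deriv[of 1 "- z"] by simp
  have B: "(1 - ?m * ?X) * fps_deriv ?B = fps_const ((z + of_real \<gamma>) * of_real \<mu>) * ?B"
    using rising_series_deriv[of "complex_of_real \<mu>" "z + of_real \<gamma>"] by simp
  have "(1 - ?X) * (1 - ?m * ?X) * fps_deriv (?A * ?B)
      = (1 - ?m * ?X) * ?B * ((1 - ?X) * fps_deriv ?A) + (1 - ?X) * ?A * ((1 - ?m * ?X) * fps_deriv ?B)"
    unfolding fps_deriv_mult by algebra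
  also have "\<dots> = (fps_const (- z) * (1 - ?m * ?X) + fps_const ((z + of_real \<gamma>) * of_real \<mu>) * (1 - ?X)) * (?A * ?B)"
    unfolding A B by algebra
  also have "fps_const (- z) * (1 - ?m * ?X) + fps_const ((z + of_real \<gamma>) * of_real \<mu>) * (1 - ?X)
      = fps_const (of_real \<mu> * (z + of_real \<gamma>) - z) - fps_const (of_real \<mu> * of_real \<gamma>) * ?X"
    by (rule fps_ext) (simp add: algebra_simps split: if_splits)
  finally show ?thesis by (simp only: gen_fun_def)
qed

text \<open>
  Comparing coefficients in the first-order differential equation for the generating function gives its
  three-term recurrence.
\<close>

lemma gen_fun_rec:
  "fps_nth (gen_fun z) 0 = 1"
  "fps_nth (gen_fun z) (Suc 0) = of_real \<mu> * (z + of_real \<gamma>) - z"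
  "of_nat (Suc (Suc n)) * fps_nth (gen_fun z) (Suc (Suc n)) =
     ((1 + of_real \<mu>) * of_nat (Suc n) + of_real \<mu> * (z + of_real \<gamma>) - z) * fps_nth (gen_fun z) (Suc n)
     - of_real \<mu> * (of_nat n + of_real \<gamma>) * fps_nth (gen_fun z) n"
proof -
  let ?X = "fps_X :: complex fps" and ?m = "complex_of_real \<mu>"
  show "fps_nth (gen_fun z) 0 = 1"
    by (simp add: gen_fun_def rising_series_def fps_mult_nth_0)
  show "fps_nth (gen_fun z) (Suc 0) = ?m * (z + of_real \<gamma>) - z"
    by (simp add: gen_fun_def rising_series_def fps_mult_nth algebra_simps)
  have "(1 - ?X) * (1 - fps_const ?m * ?X) = 1 - fps_const (1 + ?m) * ?X + fps_const ?m * (?X * ?X)"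
    by (simp add: algebra_simps flip: fps_const_add)
  then have "fps_deriv (gen_fun z) - fps_const (1 + ?m) * (?X * fps_deriv (gen_fun z)) + fps_const ?m * (?X * (?X * fps_deriv (gen_fun z)))
      = fps_const (?m * (z + of_real \<gamma>) - z) * gen_fun z - fps_const (?m * of_real \<gamma>) * (?X * gen_fun z)"
    using gen_fun_deriv[of z] by (simp only: left_diff_distrib distrib_right mult.assoc mult_1)
  from arg_cong[OF this, of "\<lambda>f. fps_nth f (Suc n)"]
  show "of_nat (Suc (Suc n)) * fps_nth (gen_fun z) (Suc (Suc n)) =
     ((1 + ?m) * of_nat (Suc n) + ?m * (z + of_real \<gamma>) - z) * fps_nth (gen_fun z) (Suc n)
     - ?m * (of_nat n + of_real \<gamma>) * fps_nth (gen_fun z) n"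
    by (cases n) (simp_all add: algebra_simps)
qed

lemma fact_gen_fun_nth: "fact n * fps_nth (gen_fun z) n = (of_real \<mu> - 1) ^ n * cM n z"
proof (induction n rule: M.induct)
  case 1 show ?case by (simp add: gen_fun_rec)
next
  case 2 show ?case using cM_rec'(1)[of z] by (simp add: gen_fun_rec del: M.simps)
next
  case (3 n)
  have "fact (Suc (Suc n)) * fps_nth (gen_fun z) (Suc (Suc n))
      = fact (Suc n) * (of_nat (Suc (Suc n)) * fps_nth (gen_fun z) (Suc (Suc n)))"
    by (simp only: fact_Suc of_nat_mult mult_ac of_nat_fact)
  also have "\<dots> = ((1 + of_real \<mu>) * of_nat (Suc n) + of_real \<mu> * (z + of_real \<gamma>) - z) * (fact (Suc n) * fps_nth (gen_fun z) (Suc n))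
     - of_real \<mu> * of_nat (Suc n) * (of_nat n + of_real \<gamma>) * (fact n * fps_nth (gen_fun z) n)"
    unfolding gen_fun_rec(3) fact_Suc[of n] of_nat_mult of_nat_fact by algebra
  also have "\<dots> = (of_real \<mu> - 1) ^ n * ((of_real \<mu> - 1)^2 * cM (Suc (Suc n)) z)"
    unfolding 3 cM_rec'(2) power_Suc by algebra
  also have "\<dots> = (of_real \<mu> - 1) ^ Suc (Suc n) * cM (Suc (Suc n)) z"
    by (simp add: power2_eq_square mult.assoc del: M.simps)
  finally show ?case .
qed

text \<open>
  This difference equation in $z$ is the coefficient form of
  $(1-\mu s) F_{z+1}(s) = (1-s) F_z(s)$ for the generating function $F_z$. It carries asymptotics from $z$ to $z+1$, and it also
  serves in the proof that $M_n$ is orthogonal to constants.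
\<close>

lemma cM_shift:
  "(of_real \<mu> - 1) * (cM (Suc n) (z + 1) - cM (Suc n) z) = of_nat (Suc n) * (of_real \<mu> * cM n (z + 1) - cM n z)"
proof -
  let ?m = "complex_of_real \<mu>"
  have "fps_nth (gen_fun (z + 1) - fps_const ?m * (fps_X * gen_fun (z + 1))) (Suc n)
      = fps_nth (gen_fun z - fps_X * gen_fun z) (Suc n)"
    using gen_fun_shift[of z] by (simp only: left_diff_distrib mult.assoc mult_1)
  then have "fps_nth (gen_fun (z + 1)) (Suc n) - ?m * fps_nth (gen_fun (z + 1)) n
      = fps_nth (gen_fun z) (Suc n) - fps_nth (gen_fun z) n"
    by simp
  then have "fact (Suc n) * fps_nth (gen_fun (z + 1)) (Suc n) - ?m * of_nat (Suc n) * (fact n * fps_nth (gen_fun (z + 1)) n)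
      = fact (Suc n) * fps_nth (gen_fun z) (Suc n) - of_nat (Suc n) * (fact n * fps_nth (gen_fun z) n)"
    unfolding fact_Suc of_nat_mult of_nat_fact by algebra
  then have "(?m - 1) ^ n * ((?m - 1) * cM (Suc n) (z + 1) - ?m * of_nat (Suc n) * cM n (z + 1))
     = (?m - 1) ^ n * ((?m - 1) * cM (Suc n) z - of_nat (Suc n) * cM n z)"
    unfolding fact_gen_fun_nth power_Suc by (simp only: right_diff_distrib mult_ac)
  moreover have "(?m - 1) ^ n \<noteq> 0"
    using mu_less_1 by (simp add: complex_eq_iff)
  ultimately have "(?m - 1) * cM (Suc n) (z + 1) - ?m * of_nat (Suc n) * cM n (z + 1)
     = (?m - 1) * cM (Suc n) z - of_nat (Suc n) * cM n z"
    using mult_left_cancel by blast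
  then show ?thesis by algebra
qed

end

section \<open>The Mehler-Heine limit\<close>

text \<open>
  Uniform convergence to $0$ on $K$ is convergence along a product filter, which makes Tannery's theorem on
  exchanging limit and sum available uniformly in $z$.
\<close>

lemma uniform_limit_tendsto_prod_filter:
  fixes f :: "'b \<Rightarrow> 'a \<Rightarrow> 'c::real_normed_vector"
  shows "uniform_limit K f (\<lambda>_. 0) F \<longleftrightarrow> ((\<lambda>(n, z). f n z) \<longlongrightarrow> 0) (F \<times>\<^sub>F principal K)"
proof -
  have "(\<forall>\<^sub>F n in F. \<forall>z\<in>K. P n z) \<longleftrightarrow> (\<forall>\<^sub>F (n, z) in F \<times>\<^sub>F principal K. P n z)" for P
    unfolding eventually_prod_filter eventually_principal split_beta
    by (auto intro: exI[of _ "\<lambda>z. z \<in> K"] elim!: eventually_mono)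
  then show ?thesis
    unfolding uniform_limit_iff tendsto_iff by (simp add: split_beta')
qed

context meixner
begin

text \<open>
  The factor $1/\Gamma(n-z)$ is the correct normalisation because $(1-s)^z$, the singular factor of the generating
  function, has coefficients $\Gamma(n-z)/(\Gamma(-z) n!)$.
\<close>

definition q :: "nat \<Rightarrow> complex \<Rightarrow> complex" where
  "q n z = (of_real \<mu> - 1) ^ n * rGamma (of_nat n - z) * cM n z"

definition Q :: "complex \<Rightarrow> complex" where
  "Q z = of_real (1 - \<mu>) powr (- (z + of_real \<gamma>)) * rGamma (- z)"

text \<open>
  Written for the increments of $q$, the three-term recurrence has no term of order one in $q_n$ itself: after division the
  coefficient of $q_n$ is $O(1/n^2)$, which makes the increments small.
\<close>

lemma q_rec:
  "(of_nat (Suc n) - z) * (of_nat n - z) * (q (Suc (Suc n)) z - q (Suc n) z)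
    = of_real \<mu> * ((of_nat n - z) * (of_nat (Suc n) + z + of_real \<gamma>) * (q (Suc n) z - q n z)
        - (z + of_real \<gamma>) * (1 + z) * q n z)"
proof -
  define G where "G = rGamma (of_nat (Suc (Suc n)) - z)"
  define x where "x = (complex_of_real \<mu> - 1) ^ n"
  have q0: "q n z = x * ((of_nat n - z) * ((of_nat (Suc n) - z) * G)) * cM n z"
    unfolding q_def x_def G_def rGamma_shift[of n] rGamma_shift[of "Suc n"] ..
  have q1: "q (Suc n) z = (of_real \<mu> - 1) * x * ((of_nat (Suc n) - z) * G) * cM (Suc n) z"
    unfolding q_def x_def G_def rGamma_shift[of "Suc n"] power_Suc ..
  have q2: "q (Suc (Suc n)) z = x * G * ((of_real \<mu> - 1)^2 * cM (Suc (Suc n)) z)"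
    unfolding q_def x_def G_def power_Suc power2_eq_square by (simp only: mult_ac)
  show ?thesis
    unfolding q2 unfolding cM_rec'(2) q0 q1 of_nat_Suc by algebra
qed

lemma q_shift:
  "(of_nat n - 1 - z) * q (Suc n) (z + 1) = of_real \<mu> * of_nat (Suc n) * q n (z + 1)
     + (of_nat n - 1 - z) * ((of_nat n - z) * q (Suc n) z - of_nat (Suc n) * q n z)"
proof -
  define G where "G = rGamma (of_nat n - z)"
  define x where "x = (complex_of_real \<mu> - 1) ^ n"
  have eqs: "of_nat (Suc n) - (z + 1) = of_nat n - z" "of_nat n - (z + 1) = of_nat n - 1 - z"
    by (simp_all add: algebra_simps)
  have g1: "rGamma (of_nat n - 1 - z) = (of_nat n - 1 - z) * G"
    using rGamma_shift[of n "z + 1"] unfolding eqs G_def .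
  have q0: "q n z = x * G * cM n z"
    unfolding q_def x_def G_def ..
  have q1: "(of_nat n - z) * q (Suc n) z = x * G * ((of_real \<mu> - 1) * cM (Suc n) z)"
    unfolding q_def x_def G_def rGamma_shift[of n] power_Suc by (simp only: mult_ac)
  have q2: "q (Suc n) (z + 1) = x * G * ((of_real \<mu> - 1) * cM (Suc n) (z + 1))"
    unfolding q_def x_def G_def eqs power_Suc by (simp only: mult_ac)
  have q3: "q n (z + 1) = x * ((of_nat n - 1 - z) * G) * cM n (z + 1)"
    unfolding q_def x_def eqs g1 ..
  show ?thesis
    unfolding q0 q1 q2 q3 using cM_shift[of n z] by algebra
qed

lemma Q_shift: "Q (z + 1) = - (z + 1) * Q z / (1 - of_real \<mu>)"
proof -
  have n0: "complex_of_real (1 - \<mu>) \<noteq> 0" using mu_less_1 by simp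
  have "complex_of_real (1 - \<mu>) powr (- (z + 1 + of_real \<gamma>))
      = complex_of_real (1 - \<mu>) powr (- (z + of_real \<gamma>)) / of_real (1 - \<mu>)"
    using powr_diff[of "complex_of_real (1 - \<mu>)" "- (z + of_real \<gamma>)" 1] n0
    by (simp add: diff_diff_eq add_ac del: of_real_diff)
  moreover have "rGamma (- (z + 1)) = - (z + 1) * rGamma (- z)"
    using rGamma_plus1[of "- (z + 1)"] by simp
  ultimately show ?thesis by (simp add: Q_def)
qed

lemma continuous_on_Q: "continuous_on A Q"
  unfolding Q_def using mu_less_1
  by (intro continuous_intros continuous_on_compose2[OF continuous_on_rGamma]) auto

lemma continuous_on_q: "continuous_on A (q n)"
  unfolding q_def
  by (intro continuous_intros continuous_on_compose2[OF continuous_on_rGamma]) auto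

lemma bounded_Q: "compact K \<Longrightarrow> bounded (Q ` K)"
  by (intro compact_imp_bounded compact_continuous_image continuous_on_Q)

text \<open>
  The quotient $\frac{n!}{(n-k)!} \, \Gamma(n-k-z)/\Gamma(n-z)$, written with Pochhammer symbols. As $n$ grows it
  tends to $1$, so that the sum in \<open>q_eq_sum\<close> becomes the binomial series of $(1-\mu)^{-z-\gamma}$.
\<close>

definition falling_ratio :: "nat \<Rightarrow> nat \<Rightarrow> complex \<Rightarrow> complex" where
  "falling_ratio n k z = fact n / fact (n - k) * pochhammer (- z) (n - k) / pochhammer (- z) n"

lemma pochhammer_uminus_nonzero:
  assumes "Re z < 0" shows "pochhammer (- z) n \<noteq> 0"
  using assms by (auto simp: pochhammer_eq_0_iff)

lemma q_eq_sum:
  assumes "Re z < 0"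
  shows "q n z = rGamma (- z) * (\<Sum>k\<le>n. falling_ratio n k z * (pochhammer (z + of_real \<gamma>) k / fact k * of_real \<mu> ^ k))"
proof -
  let ?t = "\<lambda>k. pochhammer (z + of_real \<gamma>) k / fact k * of_real \<mu> ^ k"
  have nz: "pochhammer (- z) n \<noteq> 0" by (rule pochhammer_uminus_nonzero[OF assms])
  have "rGamma (- z) = pochhammer (- z) n * rGamma (of_nat n - z)"
    using pochhammer_rGamma[of "- z" n] by (simp add: algebra_simps)
  then have G: "rGamma (of_nat n - z) = rGamma (- z) / pochhammer (- z) n"
    using nz by simp
  have "fps_nth (gen_fun z) n = (\<Sum>k=0..n. ?t k * (pochhammer (- z) (n - k) / fact (n - k)))"
    unfolding gen_fun_def by (subst mult.commute) (simp add: fps_mult_nth rising_series_def)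
  then have "q n z = fact n * (\<Sum>k=0..n. ?t k * (pochhammer (- z) (n - k) / fact (n - k))) * (rGamma (- z) / pochhammer (- z) n)"
    unfolding q_def G using fact_gen_fun_nth[of n z] by (simp add: mult_ac)
  also have "\<dots> = rGamma (- z) * (\<Sum>k=0..n. falling_ratio n k z * ?t k)"
    unfolding sum_distrib_left sum_distrib_right
    by (intro sum.cong) (simp_all add: falling_ratio_def mult_ac)
  finally show ?thesis by (simp add: atMost_atLeast0)
qed

lemma falling_ratio_0: "Re z < 0 \<Longrightarrow> falling_ratio n 0 z = 1"
  using pochhammer_uminus_nonzero[of z n] by (simp add: falling_ratio_def)

lemma falling_ratio_Suc:
  assumes "Re z < 0" "k < n"
  shows "falling_ratio n (Suc k) z = falling_ratio n k z * ((of_nat n - of_nat k) / (of_nat n - (of_nat k + 1 + z)))"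
proof -
  define m where "m = n - Suc k"
  have m: "n - k = Suc m" "n - Suc k = m" "of_nat n - of_nat k = (of_nat (Suc m) :: complex)"
    "of_nat n - (of_nat k + 1 + z) = of_nat m - z"
    using assms(2) by (auto simp: m_def of_nat_diff)
  have mz: "of_nat m - z \<noteq> 0" using assms(1) by (auto simp: complex_eq_iff)
  have s: "of_nat (Suc m) \<noteq> (0 :: complex)" by (rule of_nat_neq_0)
  have P: "pochhammer (- z) n \<noteq> 0" by (rule pochhammer_uminus_nonzero[OF assms(1)])
  have gen: "a / f * p / P = a / (s * f) * (p * w) / P * (s / w)"
    if "f \<noteq> 0" "s \<noteq> 0" "w \<noteq> 0" "P \<noteq> 0" for a f p P s w :: complex
    using that by (simp add: field_simps)
  have "pochhammer (- z) (Suc m) = pochhammer (- z) m * (of_nat m - z)"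
    by (simp add: pochhammer_Suc)
  then show ?thesis
    unfolding falling_ratio_def m using gen[OF fact_nonzero s mz P] by (simp only: fact_Suc of_nat_fact of_nat_mult)
qed

text \<open>
  By \<open>falling_ratio_Suc\<close> the ratio is a product of factors $(n-i)/(n-i-1-z)$, and for $\mathrm{Re}\, z \le -1$ the real part of
  each denominator is at least $n-i$.
\<close>

lemma norm_falling_ratio_le:
  assumes "Re z \<le> - 1" "k \<le> n"
  shows "norm (falling_ratio n k z) \<le> 1"
  using assms(2)
proof (induction k)
  case 0 show ?case using assms(1) by (simp add: falling_ratio_0)
next
  case (Suc k)
  have "real n - real k \<le> Re (of_nat n - (of_nat k + 1 + z))" using assms(1) by simp
  also have "\<dots> \<le> norm (of_nat n - (of_nat k + 1 + z))" by (rule complex_Re_le_cmod)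
  finally have w: "real n - real k \<le> norm (of_nat n - (of_nat k + 1 + z))" .
  have "norm (complex_of_nat n - of_nat k) = real n - real k"
    using Suc.prems by (metis Suc_leD norm_of_nat of_nat_diff)
  then have "norm ((of_nat n - of_nat k) / (of_nat n - (of_nat k + 1 + z))) \<le> 1"
    using w Suc.prems by (simp add: norm_divide divide_le_eq_1)
  then show ?case
    using Suc assms(1)
    by (subst falling_ratio_Suc) (auto simp: norm_mult simp del: times_divide_eq_right intro!: mult_le_one)
qed

lemma uniform_limit_falling_ratio:
  assumes "bounded K" "\<And>z. z \<in> K \<Longrightarrow> Re z < 0"
  shows "uniform_limit K (\<lambda>n z. falling_ratio n k z) (\<lambda>_. 1) sequentially"
proof (induction k)
  case 0
  show ?case
    by (subst uniform_limit_cong'[where g = "\<lambda>_ _. 1" and i = "\<lambda>_. 1"])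
       (auto simp: falling_ratio_0 assms uniform_limit_const)
next
  case (Suc k)
  have b: "bounded ((\<lambda>z. - (of_nat k + 1 + z)) ` K)" "bounded ((\<lambda>_. - of_nat k :: complex) ` K)"
    using assms(1) by (auto intro!: bounded_plus_comp bounded_minus_comp simp: image_constant_conv)
  have "uniform_limit K (\<lambda>n z. falling_ratio n k z * ((of_nat n + - of_nat k) / (of_nat n + - (of_nat k + 1 + z)))) (\<lambda>_. 1 * 1) sequentially"
    by (intro uniform_lim_mult Suc uniform_limit_ratio_shift b) (auto simp: image_constant_conv)
  moreover have "\<forall>\<^sub>F n in sequentially. \<forall>z\<in>K. falling_ratio n k z * ((of_nat n + - of_nat k) / (of_nat n + - (of_nat k + 1 + z))) = falling_ratio n (Suc k) z"
    using eventually_gt_at_top[of k] by eventually_elim (simp add: falling_ratio_Suc assms(2))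
  ultimately show ?case
    by (subst (asm) uniform_limit_cong) auto
qed

text \<open>
  Dominated convergence: the terms of \<open>q_eq_sum\<close> converge to those of the binomial series for
  $(1-\mu)^{-z-\gamma}$ and, in this half-plane, are dominated by a convergent series that depends only on a bound for $K$.
\<close>

lemma uniform_limit_q_left_half_plane:
  assumes "compact K" "\<And>z. z \<in> K \<Longrightarrow> Re z \<le> - 1"
  shows "uniform_limit K q Q sequentially"
proof (cases "K = {}")
  case False
  let ?t = "\<lambda>k z. pochhammer (z + of_real \<gamma>) k / fact k * complex_of_real \<mu> ^ k"
  from compact_imp_bounded[OF assms(1)] obtain C where C: "\<And>z. z \<in> K \<Longrightarrow> norm z \<le> C"
    by (auto simp: bounded_iff)
  define B where "B = (\<lambda>k. pochhammer (C + \<gamma>) k / fact k * \<mu> ^ k)"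
  have t_le: "norm (?t k z) \<le> B k" if "z \<in> K" for k z
  proof -
    have "norm (z + of_real \<gamma>) \<le> C + \<gamma>"
      using norm_triangle_ineq[of z "of_real \<gamma>"] C[OF that] gamma_pos by simp
    from norm_pochhammer_le[OF this, of k] mu_pos show ?thesis
      by (simp add: B_def norm_mult norm_divide norm_power divide_right_mono mult_right_mono)
  qed
  have B: "summable B"
    unfolding B_def using mu_pos mu_less_1 by (intro pochhammer_series_summable_real) auto
  \<comment> \<open>The summands minus their limits, because Tannery's theorem needs limits that are constant along the filter.\<close>
  define a where "a = (\<lambda>k (n, z). ((if k \<le> n then falling_ratio n k z else 0) - 1) * ?t k z)"
  have neg: "Re z < 0" if "z \<in> K" for z using assms(2)[OF that] by simp
  have lim: "((\<lambda>x. a k x) \<longlongrightarrow> 0) (sequentially \<times>\<^sub>F principal K)" for k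
  proof -
    have bt: "bounded (?t k ` K)"
      using t_le by (auto simp: bounded_iff)
    have "uniform_limit K (\<lambda>n z. (falling_ratio n k z - 1) * ?t k z) (\<lambda>z. (1 - 1) * ?t k z) sequentially"
      by (intro uniform_lim_mult uniform_limit_minus uniform_limit_const uniform_limit_falling_ratio neg bt compact_imp_bounded assms)
         (auto simp: image_constant_conv)
    moreover have "\<forall>\<^sub>F n in sequentially. \<forall>z\<in>K. (falling_ratio n k z - 1) * ?t k z = a k (n, z)"
      using eventually_ge_at_top[of k] by eventually_elim (simp add: a_def)
    ultimately have "uniform_limit K (\<lambda>n z. a k (n, z)) (\<lambda>_. 0) sequentially"
      by (subst (asm) uniform_limit_cong) auto
    then show ?thesis unfolding uniform_limit_tendsto_prod_filter by (simp add: split_beta')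
  qed
  have "\<forall>\<^sub>F (k, x) in at_top \<times>\<^sub>F (sequentially \<times>\<^sub>F principal K). norm (a k x) \<le> 2 * B k"
  proof -
    have "norm (a k (n, z)) \<le> 2 * B k" if "z \<in> K" for k n z
    proof -
      have "norm ((if k \<le> n then falling_ratio n k z else 0) - 1) \<le> 2"
        using norm_falling_ratio_le[OF assms(2)[OF that], of k n] norm_triangle_ineq4[of "falling_ratio n k z" 1] by auto
      then show ?thesis
        unfolding a_def prod.case norm_mult using t_le[OF that, of k]
        by (intro mult_mono) (auto simp: norm_mult norm_divide)
    qed
    moreover have "\<forall>\<^sub>F x in sequentially \<times>\<^sub>F principal K. snd x \<in> K"
      unfolding eventually_prod_filter eventually_principal
      by (intro exI[of _ "\<lambda>_. True"] exI[of _ "\<lambda>z. z \<in> K"]) auto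
    ultimately show ?thesis
      unfolding eventually_prod_filter split_beta
      by (intro exI[of _ "\<lambda>_. True"] exI[of _ "\<lambda>x. snd x \<in> K"]) auto
  qed
  moreover have "summable (\<lambda>k. 2 * B k)" using B by (rule summable_mult)
  moreover have "sequentially \<times>\<^sub>F principal K \<noteq> bot"
    using False by (simp add: prod_filter_eq_bot principal_eq_bot_iff)
  ultimately have "((\<lambda>x. \<Sum>k. a k x) \<longlongrightarrow> (\<Sum>k. 0)) (sequentially \<times>\<^sub>F principal K)"
    by (intro tannerys_theorem[THEN conjunct2, THEN conjunct2] lim)
  then have "uniform_limit K (\<lambda>n z. \<Sum>k. a k (n, z)) (\<lambda>_. 0) sequentially"
    unfolding uniform_limit_tendsto_prod_filter by (simp add: split_beta')
  then have "uniform_limit K (\<lambda>n z. rGamma (- z) * (\<Sum>k. a k (n, z)) + Q z) (\<lambda>z. rGamma (- z) * 0 + Q z) sequentially"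
    by (intro uniform_limit_add uniform_lim_mult uniform_limit_const compact_imp_bounded[OF compact_continuous_image[OF _ assms(1)]]
              continuous_intros continuous_on_compose2[OF continuous_on_rGamma])
       (auto simp: image_constant_conv)
  moreover have "rGamma (- z) * (\<Sum>k. a k (n, z)) + Q z = q n z" if "z \<in> K" for n z
  proof -
    have s1: "(\<lambda>k. if k \<le> n then falling_ratio n k z * ?t k z else 0) sums (\<Sum>k\<le>n. falling_ratio n k z * ?t k z)"
      using sums_If_finite_set[of "{..n}" "\<lambda>k. falling_ratio n k z * ?t k z"] by simp
    have s2: "(\<lambda>k. ?t k z) sums (of_real (1 - \<mu>) powr (- (z + of_real \<gamma>)))"
      using pochhammer_series_sums_complex[of "of_real \<mu>" "z + of_real \<gamma>"] mu_pos mu_less_1 by simp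
    have "(\<lambda>k. a k (n, z)) sums ((\<Sum>k\<le>n. falling_ratio n k z * ?t k z) - of_real (1 - \<mu>) powr (- (z + of_real \<gamma>)))"
      by (rule sums_cong[THEN iffD1, OF _ sums_diff[OF s1 s2]])
        (simp only: a_def prod.case left_diff_distrib mult_1_left if_distrib[of "\<lambda>x. x * _"] mult_zero_left)
    then have "(\<Sum>k. a k (n, z)) = (\<Sum>k\<le>n. falling_ratio n k z * ?t k z) - of_real (1 - \<mu>) powr (- (z + of_real \<gamma>))"
      by (rule sums_unique[symmetric])
    then show ?thesis
      unfolding q_eq_sum[OF neg[OF that]] Q_def by (simp only: right_diff_distrib mult.commute[of "rGamma (- z)" "_ powr _"] diff_add_cancel)
  qed
  ultimately show ?thesis
    by (subst (asm) uniform_limit_cong') auto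
qed auto

lemma of_nat_minus_nonzero_eventually:
  assumes "bounded K"
  shows "\<forall>\<^sub>F n in sequentially. \<forall>z\<in>K. complex_of_nat n - z \<noteq> 0"
proof -
  from assms obtain C where C: "\<And>z. z \<in> K \<Longrightarrow> norm z \<le> C"
    by (auto simp: bounded_iff)
  show ?thesis
    using eventually_gt_at_top[of "nat \<lceil>C\<rceil>"]
  proof eventually_elim
    case (elim n)
    show ?case
    proof
      fix z assume "z \<in> K"
      then have "norm z < real n" using C[of z] elim by linarith
      then show "complex_of_nat n - z \<noteq> 0" by auto
    qed
  qed
qed

text \<open>
  By \<open>q_rec\<close> the scaled increments satisfy an affine recurrence whose multiplier tends to $\mu$ and whose inhomogeneous
  part is $O(1/n)$, because $q_n$ converges and hence stays bounded on $K$.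
\<close>

lemma uniform_limit_scaled_q_diff:
  assumes "compact K" and lim: "uniform_limit K q Q sequentially"
  shows "uniform_limit K (\<lambda>n z. of_nat n * (q (Suc n) z - q n z)) (\<lambda>_. 0) sequentially"
proof -
  have K: "bounded K" using assms(1) by (rule compact_imp_bounded)
  have bd: "bounded ((\<lambda>z. z + c) ` K)" "bounded ((\<lambda>z. c - z) ` K)" "bounded ((\<lambda>z. - z) ` K)"
    "bounded ((\<lambda>z. c) ` K)" for c
    using K by (auto intro!: bounded_plus_comp bounded_minus_comp simp: image_constant_conv)
  define a where "a = (\<lambda>n (z::complex). complex_of_real \<mu> * (((of_nat n + 1) / (of_nat n + 0)) *
     ((of_nat n + (z + (1 + of_real \<gamma>))) / (of_nat n + (1 - z)))))"
  define b where "b = (\<lambda>n z. (- of_real \<mu> * (z + of_real \<gamma>) * (z + 1) * q n z) *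
     ((of_nat n + 1) / (of_nat n + (1 - z)) * (1 / (of_nat n + - z))))"
  have Q: "bounded (Q ` K)" using assms(1) by (rule bounded_Q)
  have f: "bounded ((\<lambda>z. - of_real \<mu> * (z + of_real \<gamma>) * (z + 1)) ` K)"
    by (intro compact_imp_bounded compact_continuous_image continuous_intros assms)
  have fQ: "bounded ((\<lambda>z. - of_real \<mu> * (z + of_real \<gamma>) * (z + 1) * Q z) ` K)"
    by (intro compact_imp_bounded compact_continuous_image continuous_intros assms continuous_on_Q)
  have "uniform_limit K a (\<lambda>_. of_real \<mu> * (1 * 1)) sequentially"
    unfolding a_def by (intro uniform_lim_mult uniform_limit_const uniform_limit_ratio_shift bd)
  then have a: "uniform_limit K a (\<lambda>_. of_real \<mu>) sequentially" by simp
  have "uniform_limit K b (\<lambda>z. (- of_real \<mu> * (z + of_real \<gamma>) * (z + 1) * Q z) * (1 * 0)) sequentially"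
    unfolding b_def
    by (intro uniform_lim_mult[where l = "\<lambda>z. - of_real \<mu> * (z + of_real \<gamma>) * (z + 1) * Q z"]
              uniform_lim_mult[where l = "\<lambda>z. - of_real \<mu> * (z + of_real \<gamma>) * (z + 1)"]
              uniform_lim_mult[where l = "\<lambda>z. 1"] uniform_limit_const uniform_limit_ratio_shift
              uniform_limit_inverse_shift bd f fQ Q lim)
  then have b: "uniform_limit K b (\<lambda>_. 0) sequentially" by simp
  have "\<forall>\<^sub>F n in sequentially. \<forall>z\<in>K. of_nat (Suc n) * (q (Suc (Suc n)) z - q (Suc n) z)
          = a n z * (of_nat n * (q (Suc n) z - q n z)) + b n z"
    using of_nat_minus_nonzero_eventually[OF K]
      eventually_compose_filterlim[OF of_nat_minus_nonzero_eventually[OF K] filterlim_Suc]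
      eventually_gt_at_top[of 0]
  proof eventually_elim
    case (elim n)
    show ?case
    proof
      fix z assume z: "z \<in> K"
      define u where "u = complex_of_nat n - z"
      define v where "v = complex_of_nat (Suc n) - z"
      have nz: "u \<noteq> 0" "v \<noteq> 0" "complex_of_nat n \<noteq> 0"
        using elim z by (auto simp: u_def v_def)
      have r: "v * u * (q (Suc (Suc n)) z - q (Suc n) z)
        = of_real \<mu> * (u * (of_nat (Suc n) + z + of_real \<gamma>) * (q (Suc n) z - q n z)
        - (z + of_real \<gamma>) * (1 + z) * q n z)"
        unfolding u_def v_def by (rule q_rec)
      have eq: "q (Suc (Suc n)) z - q (Suc n) z = of_real \<mu> * (u * (of_nat (Suc n) + z + of_real \<gamma>) * (q (Suc n) z - q n z)
        - (z + of_real \<gamma>) * (1 + z) * q n z) / (v * u)"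
        using nz r by (simp add: nonzero_eq_divide_eq mult_ac)
      have alt: "of_nat n + (1 - z) = v" "of_nat n + - z = u" "of_nat n + (z + (1 + of_real \<gamma>)) = of_nat (Suc n) + z + of_real \<gamma>"
        "complex_of_nat n + 1 = of_nat (Suc n)" "z + 1 = 1 + z"
        by (simp_all add: u_def v_def)
      have gen: "N * (m * (u * A * D - g * h * q0) / (v * u))
          = m * ((N / (N0 + 0)) * (A / v)) * (N0 * D) + (- m * g * h * q0) * (N / v * (1 / u))"
        if "N0 \<noteq> 0" for N N0 m A D g h q0 :: complex
        using that nz(1,2) by (simp add: divide_simps) (simp add: algebra_simps)
      show "of_nat (Suc n) * (q (Suc (Suc n)) z - q (Suc n) z)
          = a n z * (of_nat n * (q (Suc n) z - q n z)) + b n z"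
        unfolding a_def b_def alt eq by (rule gen[OF nz(3)])
    qed
  qed
  moreover have "bounded ((\<lambda>z. of_nat n * (q (Suc n) z - q n z)) ` K)" for n
    by (intro compact_imp_bounded compact_continuous_image continuous_intros continuous_on_q assms)
  ultimately have "uniform_limit K (\<lambda>n z. of_nat n * (q (Suc n) z - q n z)) (\<lambda>z. 0 / (1 - of_real \<mu>)) sequentially"
    using mu_pos mu_less_1
    by (intro uniform_limit_affine_recurrence[OF a _ b]) (simp_all add: image_constant_conv)
  then show ?thesis by simp
qed

text \<open>
  For the unknown $q_n(z+1)$ the relation \<open>q_shift\<close> is again an affine recurrence with multiplier tending to $\mu$. Its
  inhomogeneous part is $n (q_{n+1} - q_n) - z q_{n+1} - q_n$, and the first summand tends to $0$.
\<close>

lemma uniform_limit_q_shift: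
  assumes "compact K" and lim: "uniform_limit K q Q sequentially"
  shows "uniform_limit K (\<lambda>n z. q n (z + 1)) (\<lambda>z. Q (z + 1)) sequentially"
proof -
  have K: "bounded K" using assms(1) by (rule compact_imp_bounded)
  define a where "a = (\<lambda>n (z::complex). complex_of_real \<mu> * ((of_nat n + 1) / (of_nat n + (- 1 - z))))"
  define b where "b = (\<lambda>n z. of_nat n * (q (Suc n) z - q n z) - z * q (Suc n) z - q n z)"
  have bd: "bounded ((\<lambda>z. c - z) ` K)" "bounded ((\<lambda>z. c) ` K)" "bounded ((\<lambda>z. z) ` K)" for c
    using K by (auto intro!: bounded_minus_comp simp: image_constant_conv)
  have "uniform_limit K a (\<lambda>_. of_real \<mu> * 1) sequentially"
    unfolding a_def by (intro uniform_lim_mult uniform_limit_const uniform_limit_ratio_shift bd)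
  then have a: "uniform_limit K a (\<lambda>_. of_real \<mu>) sequentially" by simp
  have "uniform_limit K (\<lambda>n. q (Suc n)) Q sequentially"
    using filterlim_compose[OF lim filterlim_Suc] .
  then have "uniform_limit K b (\<lambda>z. 0 - z * Q z - Q z) sequentially"
    unfolding b_def
    by (intro uniform_limit_minus uniform_limit_scaled_q_diff uniform_lim_mult uniform_limit_const
          bd bounded_Q assms)
  then have b: "uniform_limit K b (\<lambda>z. - (z + 1) * Q z) sequentially"
    by (simp add: algebra_simps)
  have "\<forall>\<^sub>F n in sequentially. \<forall>z\<in>K. q (Suc n) (z + 1) = a n z * q n (z + 1) + b n z"
    using of_nat_minus_nonzero_eventually[OF bounded_translation[OF K, of 1]]
  proof eventually_elim
    case (elim n)
    show ?case
    proof
      fix z assume z: "z \<in> K"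
      define u where "u = complex_of_nat n - 1 - z"
      have "u \<noteq> 0" using bspec[OF elim, of "1 + z"] z by (auto simp: u_def algebra_simps)
      have r: "u * q (Suc n) (z + 1) = of_real \<mu> * of_nat (Suc n) * q n (z + 1)
         + u * ((of_nat n - z) * q (Suc n) z - of_nat (Suc n) * q n z)"
        unfolding u_def by (rule q_shift)
      have "q (Suc n) (z + 1) = (of_real \<mu> * of_nat (Suc n) * q n (z + 1)
         + u * ((of_nat n - z) * q (Suc n) z - of_nat (Suc n) * q n z)) / u"
        using r \<open>u \<noteq> 0\<close> by (metis nonzero_mult_div_cancel_left)
      also have "\<dots> = of_real \<mu> * (of_nat (Suc n) / u) * q n (z + 1) + ((of_nat n - z) * q (Suc n) z - of_nat (Suc n) * q n z)"
        using \<open>u \<noteq> 0\<close> by (simp add: field_simps del: of_nat_Suc)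
      also have "(of_nat n - z) * q (Suc n) z - of_nat (Suc n) * q n z = b n z"
        by (simp add: b_def algebra_simps)
      also have "of_real \<mu> * (of_nat (Suc n) / u) = a n z"
        by (simp add: a_def u_def algebra_simps)
      finally show "q (Suc n) (z + 1) = a n z * q n (z + 1) + b n z" .
    qed
  qed
  moreover have "bounded ((\<lambda>z. q n (z + 1)) ` K)" for n
    by (intro compact_imp_bounded compact_continuous_image continuous_on_compose2[OF continuous_on_q[of UNIV]]
          continuous_intros assms) auto
  moreover have "bounded ((\<lambda>z. - (z + 1) * Q z) ` K)"
    by (intro compact_imp_bounded compact_continuous_image continuous_intros continuous_on_Q assms)
  ultimately have "uniform_limit K (\<lambda>n z. q n (z + 1)) (\<lambda>z. (- (z + 1) * Q z) / (1 - of_real \<mu>)) sequentially"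
    using mu_pos mu_less_1
    by (intro uniform_limit_affine_recurrence[OF a _ b]) simp_all
  then show ?thesis by (simp add: Q_shift)
qed

text \<open>
  Every compact set reaches the half-plane $\mathrm{Re}\, z \le -1$ after finitely many unit shifts to the left.
\<close>

theorem uniform_limit_q:
  assumes "compact K"
  shows "uniform_limit K q Q sequentially"
proof -
  from compact_imp_bounded[OF assms] obtain C where C: "\<And>z. z \<in> K \<Longrightarrow> norm z \<le> C"
    by (auto simp: bounded_iff)
  have "uniform_limit K q Q sequentially" if "compact K" "\<And>z. z \<in> K \<Longrightarrow> Re z \<le> real m - 1" for m K
    using that
  proof (induction m arbitrary: K)
    case 0
    then show ?case by (intro uniform_limit_q_left_half_plane) auto
  next
    case (Suc m)
    let ?K = "(\<lambda>z. z - 1) ` K"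
    have "compact ?K"
      by (intro compact_continuous_image continuous_intros Suc.prems)
    moreover have "Re z \<le> real m - 1" if "z \<in> ?K" for z
      using that Suc.prems(2) by fastforce
    ultimately have "uniform_limit ?K (\<lambda>n z. q n (z + 1)) (\<lambda>z. Q (z + 1)) sequentially"
      by (intro uniform_limit_q_shift Suc.IH)
    from uniform_limit_compose'[OF this, of "\<lambda>z. z - 1" K] show ?case by simp
  qed
  moreover have "Re z \<le> real (Suc (nat \<lceil>C\<rceil>)) - 1" if "z \<in> K" for z
    using C[OF that] complex_Re_le_cmod[of z] by simp linarith
  ultimately show ?thesis using assms by blast
qed

end

section \<open>Orthogonality of the Meixner polynomials\<close>

context meixner
begin

abbreviation w :: "nat \<Rightarrow> real" where "w \<equiv> meixner_weight \<gamma> \<mu>"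

definition L :: "real poly \<Rightarrow> real" where
  "L p = (\<Sum>x. poly p (real x) * w x)"

lemma w_pos: "w x > 0"
  using gamma_pos mu_pos by (simp add: meixner_weight_def Gamma_real_pos)

lemma w_Suc: "real (Suc x) * w (Suc x) = \<mu> * (\<gamma> + real x) * w x"
proof -
  have 1: "Gamma (\<gamma> + real (Suc x)) = (\<gamma> + real x) * Gamma (\<gamma> + real x)"
    using Gamma_plus1[of "\<gamma> + real x"] gamma_pos by (force simp: add_ac dest: nonpos_Ints_nonpos)
  have 2: "Gamma (real (Suc x) + 1) = real (Suc x) * Gamma (real x + 1)"
    using Gamma_plus1[of "real x + 1"] by (force simp: add_ac dest: nonpos_Ints_nonpos)
  have "real (Suc x) \<noteq> 0" by simp
  then show ?thesis
    unfolding meixner_weight_def 1 2 by (simp del: of_nat_Suc)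
qed

lemma summable_power_w: "summable (\<lambda>x. real x ^ k * w x)"
proof -
  define r where "r = (\<lambda>x. ((real x + 1) / real x) ^ k * (\<mu> * ((\<gamma> + real x) / (real x + 1))))"
  have "(\<lambda>x. (real x + 1) / real x) \<longlonglongrightarrow> 1" "(\<lambda>x. (\<gamma> + real x) / (real x + 1)) \<longlonglongrightarrow> 1"
    by real_asymp+
  then have "r \<longlonglongrightarrow> 1 ^ k * (\<mu> * 1)"
    unfolding r_def by (intro tendsto_intros)
  then have "\<forall>\<^sub>F x in sequentially. r x < (1 + \<mu>) / 2"
    using mu_less_1 by (intro order_tendstoD) auto
  then obtain N where N: "\<And>x. x \<ge> N \<Longrightarrow> r x < (1 + \<mu>) / 2"
    by (auto simp: eventually_sequentially)
  \<comment> \<open>Consecutive terms have ratio tending to $\mu$, and $(1+\mu)/2$ lies strictly between $\mu$ and $1$.\<close>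
  show ?thesis
  proof (rule summable_ratio_test[of "(1 + \<mu>) / 2" "Suc N"])
    show "(1 + \<mu>) / 2 < 1" using mu_less_1 by simp
    fix x assume x: "x \<ge> Suc N"
    have "w (Suc x) = \<mu> * ((\<gamma> + real x) / (real x + 1)) * w x"
      using w_Suc[of x] by (simp add: field_simps)
    moreover have "real (Suc x) ^ k = ((real x + 1) / real x) ^ k * real x ^ k"
      using x by (simp add: power_divide add_ac)
    ultimately have "real (Suc x) ^ k * w (Suc x) = r x * (real x ^ k * w x)"
      by (simp add: r_def)
    also have "\<dots> \<le> (1 + \<mu>) / 2 * (real x ^ k * w x)"
      using N[of x] x w_pos[of x] by (intro mult_right_mono) auto
    finally show "norm (real (Suc x) ^ k * w (Suc x)) \<le> (1 + \<mu>) / 2 * norm (real x ^ k * w x)"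
      using w_pos[of x] w_pos[of "Suc x"] by (simp add: abs_mult)
  qed
qed

lemma summable_poly_w: "summable (\<lambda>x. poly p (real x) * w x)"
proof -
  have "summable (\<lambda>x. \<Sum>i\<le>degree p. coeff p i * (real x ^ i * w x))"
    by (intro summable_sum summable_mult summable_power_w)
  then show ?thesis
    by (simp add: poly_altdef sum_distrib_right mult.assoc)
qed

lemma L_add: "L (f + g) = L f + L g"
  unfolding L_def by (simp add: distrib_right suminf_add[OF summable_poly_w summable_poly_w])

lemma L_diff: "L (f - g) = L f - L g"
  unfolding L_def by (simp add: left_diff_distrib suminf_diff[OF summable_poly_w summable_poly_w])

lemma L_smult: "L (smult c f) = c * L f"
  unfolding L_def using suminf_mult[OF summable_poly_w[of f], of c] by (simp add: mult.assoc)

lemma L_0: "L 0 = 0"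
  by (simp add: L_def)

lemma L_sum: "finite I \<Longrightarrow> L (sum f I) = (\<Sum>i\<in>I. L (f i))"
  by (induction I rule: finite_induct) (simp_all add: L_0 L_add)

text \<open>
  Summation by a shift of the index, using the Pearson equation $(x+1) w(x+1) = \mu (\gamma+x) w(x)$; the term at $x = 0$ drops out.
\<close>

lemma L_Pearson: "L (pCons 0 f) = \<mu> * L ([:\<gamma>, 1:] * pcompose f [:1, 1:])"
proof -
  have "L (pCons 0 f) = (\<Sum>x. poly (pCons 0 f) (real (Suc x)) * w (Suc x))"
    unfolding L_def by (subst suminf_split_head[OF summable_poly_w]) simp
  also have "(\<lambda>x. poly (pCons 0 f) (real (Suc x)) * w (Suc x))
      = (\<lambda>x. \<mu> * (poly ([:\<gamma>, 1:] * pcompose f [:1, 1:]) (real x) * w x))"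
  proof
    fix x
    have "poly (pCons 0 f) (real (Suc x)) * w (Suc x) = poly f (real (Suc x)) * (real (Suc x) * w (Suc x))"
      by simp
    also have "\<dots> = poly f (real (Suc x)) * (\<mu> * (\<gamma> + real x) * w x)"
      unfolding w_Suc ..
    finally show "poly (pCons 0 f) (real (Suc x)) * w (Suc x)
        = \<mu> * (poly ([:\<gamma>, 1:] * pcompose f [:1, 1:]) (real x) * w x)"
      by (simp add: poly_pcompose algebra_simps)
  qed
  finally show ?thesis
    by (simp only: L_def suminf_mult[OF summable_poly_w])
qed

lemma M_shift:
  "(\<mu> - 1) * (poly (M (Suc n)) (x + 1) - poly (M (Suc n)) x)
    = real (Suc n) * (\<mu> * poly (M n) (x + 1) - poly (M n) x)"
proof -
  have 1: "cM k (of_real x) = of_real (poly (M k) x)" "cM k (of_real x + 1) = of_real (poly (M k) (x + 1))" for k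
    using poly_map_poly_of_real[of "M k" x] poly_map_poly_of_real[of "M k" "x + 1"] by simp_all
  have "complex_of_real ((\<mu> - 1) * (poly (M (Suc n)) (x + 1) - poly (M (Suc n)) x))
      = complex_of_real (real (Suc n) * (\<mu> * poly (M n) (x + 1) - poly (M n) x))"
    using cM_shift[of n "of_real x"] unfolding 1 by (simp del: M.simps)
  then show ?thesis by (simp only: of_real_eq_iff)
qed

text \<open>
  Applying \<open>L_Pearson\<close> to $f = (\mu-1) M_{n+1} - \mu (n+1) M_n$, whose shift is $(\mu-1) M_{n+1} - (n+1) M_n$ by \<open>M_shift\<close>, the
  contributions of $L(x M_n)$ cancel and $L(x M_{n+1})$ is expressed by $L(M_{n+1})$ and $L(M_n)$. Insertion into the
  three-term recurrence leaves a relation for the numbers $L(M_n)$ only.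
\<close>

lemma L_M_rec:
  "L (M (Suc 0)) = 0"
  "(1 - \<mu>)^2 * L (M (Suc (Suc n))) = - ((1 - \<mu>) * (1 + \<mu>) * (real n + 1) * L (M (Suc n)) + \<mu> * (real n + 1) * n * L (M n))"
proof -
  have b: "(1 - \<mu>) * diag_coeff n = (1 + \<mu>) * n + \<mu> * \<gamma>" for n
    using mu_less_1 by (simp add: diag_coeff_def)
  have c: "(1 - \<mu>)^2 * offdiag_coeff (Suc n) = \<mu> * (real n + 1) * (n + \<gamma>)"
    using mu_less_1 by (simp add: offdiag_coeff_def)
  have "[:\<gamma>, 1:] * pcompose 1 [:1, 1:] = smult \<gamma> 1 + pCons 0 1"
    by (simp add: pcompose_1 one_pCons)
  then have "L (pCons 0 1) = \<mu> * (\<gamma> * L 1 + L (pCons 0 1))"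
    using L_Pearson[of 1] by (simp only: L_add L_smult)
  moreover have "(1 - \<mu>) * diag_coeff 0 = \<mu> * \<gamma>"
    using b[of 0] by simp
  moreover have "L (M (Suc 0)) = L (pCons 0 1) - diag_coeff 0 * L 1"
    using L_diff[of "pCons 0 1" "smult (diag_coeff 0) 1"] L_smult[of "diag_coeff 0" 1]
    by (simp add: one_pCons)
  ultimately have "(1 - \<mu>) * L (M (Suc 0)) = 0"
    by algebra
  then show "L (M (Suc 0)) = 0" using mu_less_1 by simp
  define f where "f = smult (\<mu> - 1) (M (Suc n)) - smult (\<mu> * Suc n) (M n)"
  have "poly (pcompose f [:1, 1:]) = poly (smult (\<mu> - 1) (M (Suc n)) - smult (Suc n) (M n))"
  proof
    fix x
    show "poly (pcompose f [:1, 1:]) x = poly (smult (\<mu> - 1) (M (Suc n)) - smult (Suc n) (M n)) x"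
      using M_shift[of n x] by (simp add: f_def poly_pcompose algebra_simps del: M.simps)
  qed
  then have f': "pcompose f [:1, 1:] = smult (\<mu> - 1) (M (Suc n)) - smult (Suc n) (M n)"
    by (simp only: poly_eq_poly_eq_iff)
  have x: "pCons 0 f = smult (\<mu> - 1) (pCons 0 (M (Suc n))) - smult (\<mu> * Suc n) (pCons 0 (M n))"
    by (simp add: f_def del: M.simps)
  have y: "[:\<gamma>, 1:] * (smult (\<mu> - 1) (M (Suc n)) - smult (Suc n) (M n))
     = smult \<gamma> (smult (\<mu> - 1) (M (Suc n)) - smult (Suc n) (M n))
       + (smult (\<mu> - 1) (pCons 0 (M (Suc n))) - smult (Suc n) (pCons 0 (M n)))"
    by (simp del: M.simps)
  have P: "(\<mu> - 1) * L (pCons 0 (M (Suc n))) - \<mu> * Suc n * L (pCons 0 (M n))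
      = \<mu> * (\<gamma> * ((\<mu> - 1) * L (M (Suc n)) - Suc n * L (M n))
        + ((\<mu> - 1) * L (pCons 0 (M (Suc n))) - Suc n * L (pCons 0 (M n))))"
    using L_Pearson[of f] unfolding x f' y L_add L_diff L_smult .
  have R: "L (M (Suc (Suc n))) = L (pCons 0 (M (Suc n))) - diag_coeff (Suc n) * L (M (Suc n)) - offdiag_coeff (Suc n) * L (M n)"
    by (simp only: M.simps(3) L_diff L_smult)
  show "(1 - \<mu>)^2 * L (M (Suc (Suc n))) = - ((1 - \<mu>) * (1 + \<mu>) * (real n + 1) * L (M (Suc n)) + \<mu> * (real n + 1) * n * L (M n))"
    using P R b[of "Suc n"] c unfolding of_nat_Suc by algebra
qed

text \<open>
  In \<open>L_M_rec\<close> the coefficient of $L(M_n)$ carries a factor $n$, so the nonzero value $L(M_0)$ never enters and the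
  recursion starts from $L(M_1) = 0$.
\<close>

lemma L_M_Suc: "L (M (Suc n)) = 0"
proof (induction n rule: less_induct)
  case (less n)
  show ?case
  proof (cases n)
    case 0 then show ?thesis by (simp only: L_M_rec)
  next
    case (Suc m)
    have "L (M (Suc m)) = 0" "real m * L (M m) = 0"
      using less[of m] less[of "m - 1"] Suc by (cases m; simp del: M.simps)+
    then have "(1 - \<mu>)^2 * L (M (Suc n)) = 0"
      unfolding Suc L_M_rec(2) by (simp add: mult.assoc del: M.simps)
    then show ?thesis using mu_less_1 by (simp del: M.simps)
  qed
qed

fun sqnorm :: "nat \<Rightarrow> real" where
  "sqnorm 0 = L 1"
| "sqnorm (Suc n) = offdiag_coeff (Suc n) * sqnorm n"

lemma sqnorm_pos: "sqnorm n > 0"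
proof (induction n)
  case 0
  show ?case
    using suminf_pos[OF summable_poly_w[of 1]] w_pos by (simp add: L_def)
next
  case (Suc n)
  then show ?case using gamma_pos mu_pos mu_less_1 by (simp add: offdiag_coeff_def)
qed

text \<open>
  A factor $x$ can be moved from $f$ to $M_n$, where the three-term recurrence replaces it by
  $M_{n+1}$, $M_n$ and $M_{n-1}$; this lowers the degree of $f$ until only orthogonality to constants is needed.
\<close>

lemma L_mult_M: "degree f \<le> n \<Longrightarrow> L (f * M n) = coeff f n * sqnorm n"
proof (induction f arbitrary: n)
  case 0 show ?case by (simp add: L_0)
next
  case (pCons a f)
  show ?case
  proof (cases n)
    case 0
    with pCons.prems have "f = 0" by (auto simp: degree_pCons_eq_if split: if_splits)
    then show ?thesis using L_smult[of a 1] 0 by simp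
  next
    case (Suc m)
    have df: "degree f \<le> m"
      using pCons.prems Suc by (auto simp: degree_pCons_eq_if split: if_splits)
    have "pCons a f * M n = smult a (M n) + f * M (Suc n) + smult (diag_coeff n) (f * M n) + smult (offdiag_coeff n) (f * M m)"
      unfolding Suc by (simp add: algebra_simps mult_smult_right)
    then have "L (pCons a f * M n) = a * L (M n) + L (f * M (Suc n)) + diag_coeff n * L (f * M n) + offdiag_coeff n * L (f * M m)"
      by (simp only: L_add L_smult)
    also have "\<dots> = coeff f m * sqnorm n"
      using pCons.IH[of "Suc n"] pCons.IH[of n] pCons.IH[of m] df Suc L_M_Suc[of m]
      by (simp add: coeff_eq_0 del: M.simps)
    finally show ?thesis by (simp add: Suc del: M.simps)
  qed
qed

lemma degree_M_le: "degree (M n) \<le> n"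
  by (induction n rule: M.induct)
     (auto intro!: degree_diff_le order.trans[OF degree_pCons_le] order.trans[OF degree_smult_le])

lemma coeff_M: "coeff (M n) n = 1"
proof (induction n rule: M.induct)
  case (3 n)
  have "coeff (M (Suc n)) (Suc (Suc n)) = 0" "coeff (M n) (Suc (Suc n)) = 0"
    using degree_M_le[of n] degree_M_le[of "Suc n"] by (auto intro!: coeff_eq_0 simp del: M.simps)
  then show ?case using 3 by (subst M.simps(3)) (simp del: M.simps)
qed simp_all

lemma L_M_mult_M: "L (M i * M n) = (if i = n then sqnorm n else 0)"
proof -
  have "L (M i * M n) = 0" if "i < n" for i n
    using that degree_M_le[of i] by (subst L_mult_M) (auto simp: coeff_eq_0)
  from this[of i n] this[of n i] show ?thesis
    using L_mult_M[OF degree_M_le, of n] coeff_M[of n]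
    by (cases i n rule: linorder_cases) (auto simp: mult.commute[of "M i"])
qed

lemma poly_eq_0_if_orthogonal:
  "(\<And>i. i \<ge> n \<Longrightarrow> coeff f i = 0) \<Longrightarrow> (\<And>i. i < n \<Longrightarrow> L (f * M i) = 0) \<Longrightarrow> f = 0"
proof (induction n)
  case 0 then show ?case by (simp add: poly_eq_iff)
next
  case (Suc n)
  have "degree f \<le> n" using Suc.prems(1) by (intro degree_le) auto
  from L_mult_M[OF this] Suc.prems(2)[of n] sqnorm_pos[of n] have "coeff f n = 0" by simp
  then have "coeff f i = 0" if "i \<ge> n" for i
    using Suc.prems(1)[of i] that by (cases "i = n") auto
  then show ?case using Suc by auto
qed

end

section \<open>Reduction of the Sobolev polynomials to Meixner polynomials\<close>

lemma funpow_fwd_diff_linear: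
  "(fwd_diff ^^ j) (\<lambda>x. a * f x + b * g x) = (\<lambda>x. a * (fwd_diff ^^ j) f x + b * (fwd_diff ^^ j) g x)"
  by (induction j) (auto simp: fwd_diff_def algebra_simps)

locale meixner_sobolev = meixner +
  fixes \<alpha> lam :: real and j :: nat and S :: "nat \<Rightarrow> real poly"
  assumes alpha_neg: "\<alpha> < 0" and lam_pos: "lam > 0" and S: "monic_meixner_sobolev \<gamma> \<mu> \<alpha> lam j S"
begin

definition \<delta> :: "real poly \<Rightarrow> real" where
  "\<delta> p = (fwd_diff ^^ j) (poly p) \<alpha>"

lemma \<delta>_linear: "\<delta> (smult a f + smult b g) = a * \<delta> f + b * \<delta> g"
proof -
  have "poly (smult a f + smult b g) = (\<lambda>x. a * poly f x + b * poly g x)" by auto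
  then show ?thesis by (simp only: \<delta>_def funpow_fwd_diff_linear)
qed

lemma \<delta>_add: "\<delta> (f + g) = \<delta> f + \<delta> g"
  using \<delta>_linear[of 1 f 1 g] by simp

lemma \<delta>_diff: "\<delta> (f - g) = \<delta> f - \<delta> g"
  using \<delta>_linear[of 1 f "- 1" g] by simp

lemma \<delta>_smult: "\<delta> (smult a f) = a * \<delta> f"
  using \<delta>_linear[of a f 0 0] by simp

lemma \<delta>_0: "\<delta> 0 = 0"
  using \<delta>_smult[of 0 0] by simp

lemma \<delta>_sum: "finite I \<Longrightarrow> \<delta> (sum f I) = (\<Sum>i\<in>I. \<delta> (f i))"
  by (induction I rule: finite_induct) (simp_all add: \<delta>_add \<delta>_0)

definition sobolev_form :: "real poly \<Rightarrow> real poly \<Rightarrow> real" where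
  "sobolev_form f g = L (f * g) + lam * \<delta> f * \<delta> g"

lemma sobolev_inner_eq: "sobolev_inner \<gamma> \<mu> \<alpha> lam j f g = sobolev_form f g"
  by (simp add: sobolev_inner_def sobolev_form_def L_def \<delta>_def)

lemma S_props: "coeff (S n) n = 1" "degree (S n) = n" "m \<noteq> n \<Longrightarrow> sobolev_form (S m) (S n) = 0"
  using S unfolding monic_meixner_sobolev_def sobolev_inner_eq by metis+

lemma coeff_S_eq_0: "i > n \<Longrightarrow> coeff (S n) i = 0"
  using S_props(2)[of n] by (auto intro: coeff_eq_0)

text \<open>
  A polynomial of degree less than $n$ is reduced to $0$ by subtracting multiples of $S_m$ with $m < n$.
\<close>

lemma sobolev_form_S_lower:
  "m \<le> n \<Longrightarrow> (\<And>i. i \<ge> m \<Longrightarrow> coeff g i = 0) \<Longrightarrow> sobolev_form (S n) g = 0"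
proof (induction m arbitrary: g)
  case 0
  then have "g = 0" by (simp add: poly_eq_iff)
  then show ?case by (simp add: sobolev_form_def L_0 \<delta>_0)
next
  case (Suc m)
  define h where "h = g - smult (coeff g m) (S m)"
  have "coeff h i = 0" if "i \<ge> m" for i
    using that Suc.prems(2)[of i] coeff_S_eq_0[of m i] S_props(1)[of m]
    by (cases "i = m") (auto simp: h_def)
  then have "sobolev_form (S n) h = 0" using Suc by auto
  moreover have "sobolev_form (S n) h = sobolev_form (S n) g - coeff g m * sobolev_form (S n) (S m)"
    by (simp add: h_def sobolev_form_def \<delta>_diff \<delta>_smult right_diff_distrib L_diff L_smult) (simp add: algebra_simps)
  moreover have "sobolev_form (S n) (S m) = 0" using Suc.prems(1) by (intro S_props) auto
  ultimately show ?case by simp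
qed

definition D :: "nat \<Rightarrow> real" where "D n = \<delta> (M n)"

text \<open>
  The Christoffel-Darboux kernel $\sum_{i<n} M_i(x) M_i(y)/h_i$ with $\Delta^j$ applied in $y$ at $y = \alpha$.
\<close>

definition kernel :: "nat \<Rightarrow> real poly" where
  "kernel n = (\<Sum>i<n. smult (D i / sqnorm i) (M i))"

definition W :: "nat \<Rightarrow> real" where
  "W n = 1 / lam + (\<Sum>i<n. (D i)^2 / sqnorm i)"

lemma W_pos: "W n > 0"
  unfolding W_def using lam_pos sqnorm_pos
  by (intro add_pos_nonneg sum_nonneg) (auto simp: less_imp_le)

text \<open>
  The difference of the two sides has degree less than $n$. Since $S_n$ is Sobolev-orthogonal to $M_i$ for
  $i < n$, its plain product with $M_i$ is $L(S_n M_i) = -\lambda\, \delta(S_n) D_i$, which is exactly what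
  the kernel term compensates.
\<close>

lemma S_eq_delta: "S n = M n - smult (lam * \<delta> (S n)) (kernel n)"
proof -
  define f where "f = S n - M n + smult (lam * \<delta> (S n)) (kernel n)"
  have "coeff f i = 0" if "i \<ge> n" for i
  proof -
    have "coeff (M k) i = 0" if "k < n" for k
      using degree_M_le[of k] that \<open>i \<ge> n\<close> by (intro coeff_eq_0) linarith
    then have "coeff (kernel n) i = 0"
      unfolding kernel_def coeff_sum by (intro sum.neutral) simp
    moreover have "coeff (S n) i = coeff (M n) i"
    proof (cases "i = n")
      case True then show ?thesis by (simp only: S_props coeff_M)
    next
      case False
      with that show ?thesis
        using coeff_S_eq_0[of n i] coeff_eq_0[of "M n" i] degree_M_le[of n] by simp
    qed
    ultimately show ?thesis by (simp add: f_def)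
  qed
  moreover have "L (f * M i) = 0" if "i < n" for i
  proof -
    have "L (kernel n * M i) = (\<Sum>k<n. D k / sqnorm k * L (M k * M i))"
      unfolding kernel_def sum_distrib_right by (subst L_sum) (simp_all add: L_smult)
    also have "\<dots> = (\<Sum>k<n. if k = i then D i else 0)"
      using sqnorm_pos[of i] by (intro sum.cong refl) (auto simp: L_M_mult_M)
    also have "\<dots> = D i" using that by simp
    finally have LA: "L (kernel n * M i) = D i" .
    have "sobolev_form (S n) (M i) = 0"
      using that degree_M_le[of i] by (intro sobolev_form_S_lower[of "Suc i"]) (auto intro!: coeff_eq_0)
    moreover have "L (f * M i) = L (S n * M i) - L (M n * M i) + lam * \<delta> (S n) * L (kernel n * M i)"
      by (simp add: f_def distrib_right left_diff_distrib L_add L_diff L_smult)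
    ultimately show ?thesis
      using that unfolding LA by (simp add: L_M_mult_M sobolev_form_def D_def)
  qed
  ultimately have "f = 0" by (rule poly_eq_0_if_orthogonal)
  then show ?thesis unfolding f_def by (simp add: algebra_simps)
qed

text \<open>
  Applying $\delta$ to \<open>S_eq_delta\<close> gives a linear equation for the unknown number $\delta(S_n)$.
\<close>

lemma S_eq: "S n = M n - smult (D n / W n) (kernel n)"
proof -
  have "\<delta> (kernel n) = (\<Sum>i<n. (D i)^2 / sqnorm i)"
    unfolding kernel_def by (subst \<delta>_sum) (simp_all add: \<delta>_smult D_def power2_eq_square)
  then have delta_kernel: "\<delta> (kernel n) = W n - 1 / lam" by (simp add: W_def)
  have "\<delta> (S n) = D n - lam * \<delta> (S n) * \<delta> (kernel n)"
    using arg_cong[OF S_eq_delta[of n], of \<delta>] by (simp add: \<delta>_diff \<delta>_smult D_def)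
  then have "lam * \<delta> (S n) * W n = D n"
    unfolding delta_kernel using lam_pos by (simp add: field_simps)
  then have "lam * \<delta> (S n) = D n / W n"
    using W_pos[of n] by (simp add: field_simps)
  then show ?thesis using S_eq_delta[of n] by simp
qed

text \<open>
  The kernel sum is eliminated between \<open>S_eq\<close> for $n$ and for $n+1$.
\<close>

lemma S_rec:
  assumes "D n \<noteq> 0"
  shows "S (Suc n) = M (Suc n) - smult (D (Suc n) / D n) (M n)
    + smult (D (Suc n) / D n * (W n / W (Suc n))) (S n)"
proof -
  let ?r = "D (Suc n) / D n"
  have kernel_Suc: "kernel (Suc n) = kernel n + smult (D n / sqnorm n) (M n)" by (simp add: kernel_def)
  have W: "W (Suc n) = W n + (D n)^2 / sqnorm n" by (simp add: W_def)
  have nz: "W n \<noteq> 0" "W (Suc n) \<noteq> 0" using W_pos[of n] W_pos[of "Suc n"] by auto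
  have c1: "D (Suc n) / W (Suc n) = ?r * (W n / W (Suc n)) * (D n / W n)"
    using nz assms by (simp add: field_simps)
  have c2: "D (Suc n) / W (Suc n) * (D n / sqnorm n) = ?r - ?r * (W n / W (Suc n))"
  proof -
    have "?r - ?r * (W n / W (Suc n)) = ?r * (W (Suc n) - W n) / W (Suc n)"
      using nz by (simp add: right_diff_distrib diff_divide_distrib)
    also have "W (Suc n) - W n = (D n)^2 / sqnorm n" using W by simp
    finally show ?thesis using assms by (simp add: power2_eq_square)
  qed
  have "smult (D (Suc n) / W (Suc n)) (kernel (Suc n))
      = smult (?r * (W n / W (Suc n))) (smult (D n / W n) (kernel n)) + smult (?r - ?r * (W n / W (Suc n))) (M n)"
    unfolding kernel_Suc smult_add_right smult_smult c1[symmetric] c2 ..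
  then show ?thesis
    using S_eq[of n] S_eq[of "Suc n"]
    by (simp add: smult_diff_right smult_diff_left del: M.simps)
qed

end

section \<open>Asymptotics of the differences at $\alpha$\<close>

text \<open>
  Convergence with increments $o(1/n)$: a weakening of a full expansion in powers of $1/n$ that is stable under sums and
  products and is enough to compare consecutive terms.
\<close>

definition slow_limit :: "(nat \<Rightarrow> real) \<Rightarrow> real \<Rightarrow> bool" where
  "slow_limit u l \<longleftrightarrow> u \<longlonglongrightarrow> l \<and> (\<lambda>n. real n * (u (Suc n) - u n)) \<longlonglongrightarrow> 0"

lemma slow_limit_diff:
  assumes "slow_limit u l" "slow_limit v m"
  shows "slow_limit (\<lambda>n. u n - v n) (l - m)"
proof -
  have "(\<lambda>n. real n * (u (Suc n) - u n) - real n * (v (Suc n) - v n)) \<longlonglongrightarrow> 0 - 0"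
    using assms by (intro tendsto_diff) (auto simp: slow_limit_def)
  then show ?thesis
    using assms by (auto simp: slow_limit_def algebra_simps intro!: tendsto_intros)
qed

lemma slow_limit_mult:
  assumes "slow_limit u l" "slow_limit v m"
  shows "slow_limit (\<lambda>n. u n * v n) (l * m)"
proof -
  have "(\<lambda>n. v (Suc n)) \<longlonglongrightarrow> m"
    using assms(2) by (simp add: slow_limit_def filterlim_sequentially_Suc)
  then have "(\<lambda>n. (real n * (u (Suc n) - u n)) * v (Suc n) + u n * (real n * (v (Suc n) - v n))) \<longlonglongrightarrow> 0 * m + l * 0"
    using assms by (intro tendsto_intros) (auto simp: slow_limit_def)
  then show ?thesis
    using assms by (auto simp: slow_limit_def algebra_simps intro!: tendsto_intros)
qed

lemma slow_limit_cong:
  assumes "\<forall>\<^sub>F n in sequentially. u n = v n" "slow_limit u l"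
  shows "slow_limit v l"
proof -
  have "\<forall>\<^sub>F n in sequentially. u (Suc n) = v (Suc n)"
    using eventually_compose_filterlim[OF assms(1) filterlim_Suc] .
  with assms(1) have "\<forall>\<^sub>F n in sequentially. real n * (u (Suc n) - u n) = real n * (v (Suc n) - v n)"
    by eventually_elim simp
  from tendsto_cong[OF this] tendsto_cong[OF assms(1)] show ?thesis
    using assms(2) by (simp add: slow_limit_def)
qed

lemma slow_limit_inverse_shift: "slow_limit (\<lambda>n. 1 / (real n - x)) 0"
  unfolding slow_limit_def by (intro conjI; real_asymp)

context meixner
begin

definition scaled :: "nat \<Rightarrow> (real \<Rightarrow> real) \<Rightarrow> real \<Rightarrow> real" where
  "scaled n f x = (\<mu> - 1) ^ n * rGamma (real n - x) * f x"

text \<open>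
  Normalising $f_n(x+1)$ by $\Gamma(n-x)$ instead of $\Gamma(n-x-1)$ costs a factor $1/(n-x-1)$, so only $-f_n(x)$ contributes to the limit.
\<close>

lemma slow_limit_scaled_fwd_diff:
  assumes "\<And>x. slow_limit (\<lambda>n. scaled n (f n) x) (l x)"
  shows "slow_limit (\<lambda>n. scaled n (fwd_diff (f n)) x) (- l x)"
proof -
  have "slow_limit (\<lambda>n. scaled n (f n) (x + 1) * (1 / (real n - (x + 1))) - scaled n (f n) x) (l (x + 1) * 0 - l x)"
    by (intro slow_limit_diff slow_limit_mult slow_limit_inverse_shift assms)
  moreover have "\<forall>\<^sub>F n in sequentially. scaled n (f n) (x + 1) * (1 / (real n - (x + 1))) - scaled n (f n) x
      = scaled n (fwd_diff (f n)) x"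
    using eventually_gt_at_top[of "nat \<lceil>x + 1\<rceil>"]
  proof eventually_elim
    case (elim n)
    then have nz: "real n - (x + 1) \<noteq> 0" by linarith
    have "rGamma (real n - (x + 1)) = (real n - (x + 1)) * rGamma (real n - x)"
      using rGamma_plus1[of "real n - (x + 1)"] by simp
    with nz show ?case
      by (simp add: scaled_def fwd_diff_def right_diff_distrib)
  qed
  ultimately show ?thesis by (auto dest: slow_limit_cong)
qed

lemma slow_limit_scaled_funpow_fwd_diff:
  assumes "\<And>x. slow_limit (\<lambda>n. scaled n (f n) x) (l x)"
  shows "slow_limit (\<lambda>n. scaled n ((fwd_diff ^^ j) (f n)) x) ((- 1) ^ j * l x)"
proof (induction j arbitrary: x)
  case (Suc j)
  then show ?case
    using slow_limit_scaled_fwd_diff[of "\<lambda>n. (fwd_diff ^^ j) (f n)" "\<lambda>x. (- 1) ^ j * l x" x] by simp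
qed (simp add: assms)

definition Qr :: "real \<Rightarrow> real" where
  "Qr x = (1 - \<mu>) powr (- (x + \<gamma>)) * rGamma (- x)"

lemma Q_of_real: "Q (of_real x) = of_real (Qr x)"
proof -
  have "complex_of_real (1 - \<mu>) powr complex_of_real (- (x + \<gamma>)) = of_real ((1 - \<mu>) powr (- (x + \<gamma>)))"
    using mu_less_1 by (intro powr_of_real) simp
  moreover have "rGamma (complex_of_real (- x)) = of_real (rGamma (- x))"
    by (rule rGamma_complex_of_real)
  ultimately show ?thesis by (simp add: Q_def Qr_def)
qed

lemma q_of_real: "q n (of_real x) = of_real (scaled n (poly (M n)) x)"
  using rGamma_complex_of_real[of "real n - x"]
  by (simp add: q_def scaled_def poly_map_poly_of_real)

lemma slow_limit_scaled_M: "slow_limit (\<lambda>n. scaled n (poly (M n)) x) (Qr x)"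
proof -
  have u: "uniform_limit {complex_of_real x} q Q sequentially"
    by (rule uniform_limit_q) simp
  then have "(\<lambda>n. complex_of_real (scaled n (poly (M n)) x)) \<longlonglongrightarrow> complex_of_real (Qr x)"
    by (simp add: q_of_real Q_of_real)
  moreover have "(\<lambda>n. complex_of_real (real n * (scaled (Suc n) (poly (M (Suc n))) x - scaled n (poly (M n)) x))) \<longlonglongrightarrow> complex_of_real 0"
    using uniform_limit_scaled_q_diff[OF _ u] by (simp add: q_of_real del: M.simps)
  ultimately show ?thesis
    unfolding slow_limit_def tendsto_of_real_iff by blast
qed

end

context meixner_sobolev
begin

definition d :: "nat \<Rightarrow> real" where
  "d n = (\<mu> - 1) ^ n * rGamma (real n - \<alpha>) * D n"

lemma slow_limit_d: "slow_limit d ((- 1) ^ j * Qr \<alpha>)"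
  using slow_limit_scaled_funpow_fwd_diff[OF slow_limit_scaled_M, of j \<alpha>]
  unfolding d_def D_def \<delta>_def scaled_def .

text \<open>
  The value $1/\Gamma(-\alpha)$ is nonzero because $-\alpha$ is positive.
\<close>

lemma d_limit_nonzero: "(- 1) ^ j * Qr \<alpha> \<noteq> 0"
  using mu_less_1 alpha_neg by (auto simp: Qr_def rGamma_eq_zero_iff dest: nonpos_Ints_nonpos)

lemma eventually_d_nonzero: "\<forall>\<^sub>F n in sequentially. d n \<noteq> 0"
  using slow_limit_d d_limit_nonzero tendsto_imp_eventually_ne unfolding slow_limit_def by blast

lemma eventually_D_nonzero: "\<forall>\<^sub>F n in sequentially. D n \<noteq> 0"
  using eventually_d_nonzero by eventually_elim (auto simp: d_def)

text \<open>
  The quotient of $(\mu-1) D_{n+1}/D_n$ by $n - \alpha$, as \<open>D_ratio\<close> shows. Its distance from $1$ is $o(1/n)$.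
\<close>

definition \<kappa> :: "nat \<Rightarrow> real" where "\<kappa> n = d (Suc n) / d n"

lemma kappa_limit: "\<kappa> \<longlonglongrightarrow> 1"
proof -
  have "d \<longlonglongrightarrow> (- 1) ^ j * Qr \<alpha>" "(\<lambda>n. d (Suc n)) \<longlonglongrightarrow> (- 1) ^ j * Qr \<alpha>"
    using slow_limit_d by (auto simp: slow_limit_def filterlim_sequentially_Suc)
  from tendsto_divide[OF this(2,1) d_limit_nonzero] show ?thesis
    using d_limit_nonzero by (simp add: \<kappa>_def[abs_def])
qed

lemma kappa_defect_limit: "(\<lambda>n. (real n - \<alpha>) * (1 - \<kappa> n)) \<longlonglongrightarrow> 0"
proof -
  have lim: "d \<longlonglongrightarrow> (- 1) ^ j * Qr \<alpha>" "(\<lambda>n. real n * (d (Suc n) - d n)) \<longlonglongrightarrow> 0"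
    using slow_limit_d by (auto simp: slow_limit_def)
  have "(\<lambda>n. - (real n * (d (Suc n) - d n)) / d n - \<alpha> * (1 - \<kappa> n)) \<longlonglongrightarrow> - 0 / ((- 1) ^ j * Qr \<alpha>) - \<alpha> * (1 - 1)"
    by (intro tendsto_intros lim kappa_limit d_limit_nonzero)
  moreover have "\<forall>\<^sub>F n in sequentially. - (real n * (d (Suc n) - d n)) / d n - \<alpha> * (1 - \<kappa> n) = (real n - \<alpha>) * (1 - \<kappa> n)"
    using eventually_d_nonzero by eventually_elim (simp add: \<kappa>_def field_simps)
  ultimately show ?thesis by (simp add: tendsto_cong)
qed

lemma D_ratio: "(\<mu> - 1) * (D (Suc n) / D n) = (real n - \<alpha>) * \<kappa> n"
proof -
  define G where "G = rGamma (real (Suc n) - \<alpha>)"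
  have G: "G \<noteq> 0"
    using alpha_neg by (auto simp: G_def rGamma_eq_zero_iff dest: nonpos_Ints_nonpos)
  have na: "real n - \<alpha> \<noteq> 0" using alpha_neg by simp
  have "rGamma (real n - \<alpha>) = (real n - \<alpha>) * G"
    using rGamma_plus1[of "real n - \<alpha>"] by (simp add: G_def algebra_simps)
  then have "\<kappa> n = (\<mu> - 1) * (\<mu> - 1) ^ n * G * D (Suc n) / ((\<mu> - 1) ^ n * ((real n - \<alpha>) * G) * D n)"
    by (simp add: \<kappa>_def d_def G_def)
  also have "\<dots> = (\<mu> - 1) * (D (Suc n) / D n) / (real n - \<alpha>)"
    using G mu_less_1 by (simp add: divide_simps)
  finally show ?thesis using na by simp
qed

text \<open>
  The summands $u_n = D_n^2/h_n$ of $W_n$ satisfy $u_n/u_{n+1} \to \mu$, so they grow geometrically and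
  $W_n/u_n$ obeys an affine recurrence with limit $\mu/(1-\mu)$.
\<close>

lemma W_ratio_limit: "(\<lambda>n. W n / W (Suc n)) \<longlonglongrightarrow> \<mu>"
proof -
  define u where "u = (\<lambda>n. (D n)^2 / sqnorm n)"
  define g where "g = (\<lambda>n. \<mu> * ((real n + 1) * (real n + \<gamma>) / (real n - \<alpha>)^2) / (\<kappa> n)^2)"
  have W: "W (Suc n) = W n + u n" for n by (simp add: W_def u_def)
  have "(\<lambda>n. (real n + 1) * (real n + \<gamma>) / (real n - \<alpha>)^2) \<longlonglongrightarrow> 1"
    by real_asymp
  then have "g \<longlonglongrightarrow> \<mu> * 1 / 1^2"
    unfolding g_def by (intro tendsto_intros kappa_limit) simp_all
  then have g: "g \<longlonglongrightarrow> \<mu>" by simp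
  have step: "\<forall>\<^sub>F n in sequentially. u n / u (Suc n) = g n"
    using eventually_D_nonzero eventually_compose_filterlim[OF eventually_D_nonzero filterlim_Suc]
  proof eventually_elim
    case (elim n)
    have m: "(1 - \<mu>)^2 \<noteq> 0" using mu_less_1 by simp
    have "u n / u (Suc n) = offdiag_coeff (Suc n) / (D (Suc n) / D n)^2"
      using elim sqnorm_pos[of n] sqnorm_pos[of "Suc n"] by (simp add: u_def power_divide field_simps)
    also have "offdiag_coeff (Suc n) = \<mu> * ((real n + 1) * (real n + \<gamma>)) / (1 - \<mu>)^2"
      by (simp add: offdiag_coeff_def)
    also have "\<mu> * ((real n + 1) * (real n + \<gamma>)) / (1 - \<mu>)^2 / (D (Suc n) / D n)^2
        = \<mu> * ((real n + 1) * (real n + \<gamma>)) / ((\<mu> - 1) * (D (Suc n) / D n))^2"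
      by (simp add: power_mult_distrib power_divide power2_commute[of \<mu>])
    also have "\<dots> = g n"
      unfolding D_ratio g_def by (simp add: power_mult_distrib)
    finally show ?case .
  qed
  have v: "uniform_limit {()} (\<lambda>n _. W n / u n) (\<lambda>_. \<mu> / (1 - \<mu>)) sequentially"
  proof (rule uniform_limit_affine_recurrence)
    show "uniform_limit {()} (\<lambda>n _. g n) (\<lambda>_. \<mu>) sequentially" "uniform_limit {()} (\<lambda>n _. g n) (\<lambda>_. \<mu>) sequentially"
      using g by simp_all
    show "norm \<mu> < 1" using mu_pos mu_less_1 by simp
    show "\<forall>\<^sub>F n in sequentially. \<forall>z\<in>{()}. W (Suc n) / u (Suc n) = g n * (W n / u n) + g n"
      using step eventually_D_nonzero
    proof eventually_elim
      case (elim n)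
      have "u n \<noteq> 0" using elim sqnorm_pos[of n] by (simp add: u_def)
      then have "W (Suc n) / u (Suc n) = (W n / u n + 1) * (u n / u (Suc n))"
        by (simp add: W add_divide_distrib distrib_right)
      then show ?case using elim by (simp add: distrib_left mult.commute)
    qed
  qed simp_all
  then have v': "(\<lambda>n. W n / u n) \<longlonglongrightarrow> \<mu> / (1 - \<mu>)" by simp
  have lim: "(\<lambda>n. (W n / u n) / (W n / u n + 1)) \<longlonglongrightarrow> (\<mu> / (1 - \<mu>)) / (\<mu> / (1 - \<mu>) + 1)"
    using mu_less_1 by (intro tendsto_divide tendsto_add tendsto_const v') (simp add: field_simps)
  have eq: "(\<mu> / (1 - \<mu>)) / (\<mu> / (1 - \<mu>) + 1) = \<mu>"
    using mu_less_1 by (simp add: field_simps)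
  have "\<forall>\<^sub>F n in sequentially. (W n / u n) / (W n / u n + 1) = W n / W (Suc n)"
    using eventually_D_nonzero
  proof eventually_elim
    case (elim n)
    have "u n \<noteq> 0" using elim sqnorm_pos[of n] by (simp add: u_def)
    then have "W n / u n + 1 = W (Suc n) / u n" by (simp add: W add_divide_distrib)
    then show ?case using \<open>u n \<noteq> 0\<close> by simp
  qed
  from tendsto_cong[OF this] lim show ?thesis unfolding eq by blast
qed

section \<open>The limit of the Sobolev polynomials\<close>

definition T :: "nat \<Rightarrow> complex \<Rightarrow> complex" where
  "T n z = (of_real \<mu> - 1) ^ n * of_nat n * rGamma (of_nat n - z) * poly (map_poly complex_of_real (S n)) z"

text \<open>
  The normalised form of \<open>S_rec\<close>. With $(\mu-1) D_{n+1}/D_n = (n-\alpha) \kappa_n$ the inhomogeneous part becomes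
  $(n+1) (q_{n+1} - \frac{n-\alpha}{n-z} \kappa_n q_n)$. It is written here as a multiple of the increment of $q$ plus a multiple of
  $(n-z) - (n-\alpha) \kappa_n = (\alpha - z) + (n-\alpha)(1-\kappa_n)$, so that each factor has a visible limit.
\<close>

lemma T_rec:
  assumes "D n \<noteq> 0" "n > 0" "of_nat n - z \<noteq> 0"
  shows "T (Suc n) z = of_real (W n / W (Suc n) * \<kappa> n) *
      ((of_nat n - of_real \<alpha>) / (of_nat n - z) * ((of_nat n + 1) / of_nat n)) * T n z
    + ((of_nat n + 1) / of_nat n * (of_nat n * (q (Suc n) z - q n z))
       + (of_nat n + 1) / (of_nat n - z) * (q n z * ((of_real \<alpha> - z) + of_real ((real n - \<alpha>) * (1 - \<kappa> n)))))"
proof -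
  define G where "G = rGamma (of_nat (Suc n) - z)"
  define x where "x = (complex_of_real \<mu> - 1) ^ n"
  define N where "N = complex_of_nat n"
  define r where "r = complex_of_real (D (Suc n) / D n)"
  define \<rho> where "\<rho> = complex_of_real (W n / W (Suc n))"
  define s where "s = poly (map_poly complex_of_real (S n)) z"
  define k where "k = complex_of_real (\<kappa> n)"
  define m where "m = complex_of_real \<mu>"
  define a where "a = complex_of_real \<alpha>"
  have N: "N \<noteq> 0" "N - z \<noteq> 0" using assms by (simp_all add: N_def)
  have r: "(m - 1) * r = (N - a) * k"
    using arg_cong[OF D_ratio[of n], of complex_of_real] by (simp add: r_def N_def k_def m_def a_def)
  have T0: "T n z = x * N * ((N - z) * G) * s"
    unfolding T_def x_def N_def G_def s_def rGamma_shift[of n] ..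
  have q0: "q n z = x * ((N - z) * G) * cM n z"
    unfolding q_def x_def N_def G_def rGamma_shift[of n] ..
  have q1: "q (Suc n) z = (m - 1) * x * G * cM (Suc n) z"
    unfolding q_def x_def m_def G_def power_Suc ..
  have "poly (map_poly complex_of_real (S (Suc n))) z = cM (Suc n) z - r * cM n z + r * \<rho> * s"
    unfolding S_rec[OF assms(1)]
    by (simp add: map_poly_of_real_add map_poly_of_real_diff map_poly_of_real_smult r_def \<rho>_def s_def del: M.simps)
  then have T1: "T (Suc n) z = (m - 1) * x * (N + 1) * G * (cM (Suc n) z - r * cM n z + r * \<rho> * s)"
    unfolding T_def x_def N_def G_def m_def power_Suc by (simp add: add.commute)
  have "T (Suc n) z = (N + 1) * q (Suc n) z - x * (N + 1) * G * cM n z * ((m - 1) * r) + x * (N + 1) * G * \<rho> * s * ((m - 1) * r)"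
    unfolding T1 q1 by algebra
  also have "\<dots> = (N + 1) * q (Suc n) z - (N + 1) / (N - z) * q n z * ((N - a) * k) + (N + 1) / N / (N - z) * \<rho> * ((N - a) * k) * T n z"
  proof -
    have e: "x * G * cM n z = q n z / (N - z)" "x * G * s = T n z / (N * (N - z))"
      using N by (simp_all add: q0 T0)
    have "(N + 1) * q (Suc n) z - x * (N + 1) * G * cM n z * ((m - 1) * r) + x * (N + 1) * G * \<rho> * s * ((m - 1) * r)
      = (N + 1) * q (Suc n) z - (N + 1) * (x * G * cM n z) * ((N - a) * k) + (N + 1) * \<rho> * ((N - a) * k) * (x * G * s)"
      unfolding r by (simp only: mult_ac)
    then show ?thesis unfolding e by (simp add: mult_ac)
  qed
  also have "\<dots> = \<rho> * k * ((N - a) / (N - z) * ((N + 1) / N)) * T n z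
      + ((N + 1) / N * (N * (q (Suc n) z - q n z)) + (N + 1) / (N - z) * (q n z * ((a - z) + (N - a) * (1 - k))))"
  proof -
    have gen: "(N + 1) / u * (y * (u - R)) = (N + 1) * y - (N + 1) / u * y * R" if "u \<noteq> 0" for u y R :: complex
      using that by (simp add: field_simps)
    have "(a - z) + (N - a) * (1 - k) = (N - z) - (N - a) * k" by algebra
    then have "(N + 1) / (N - z) * (q n z * ((a - z) + (N - a) * (1 - k)))
       = (N + 1) * q n z - (N + 1) / (N - z) * q n z * ((N - a) * k)"
      using gen[OF N(2)] by (simp only:)
    moreover have "(N + 1) / N * (N * (q (Suc n) z - q n z)) = (N + 1) * q (Suc n) z - (N + 1) * q n z"
      using N by (simp add: right_diff_distrib)
    moreover have "(N + 1) / N / (N - z) * \<rho> * ((N - a) * k) * T n z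
        = \<rho> * k * ((N - a) / (N - z) * ((N + 1) / N)) * T n z"
      by (simp add: mult_ac)
    ultimately show ?thesis by simp
  qed
  finally show ?thesis
    by (simp add: \<rho>_def k_def a_def N_def)
qed

theorem uniform_limit_T:
  assumes "compact K"
  shows "uniform_limit K T (\<lambda>z. Q z * (of_real \<alpha> - z) / (1 - of_real \<mu>)) sequentially"
proof -
  have K: "bounded K" using assms by (rule compact_imp_bounded)
  have bd: "bounded ((\<lambda>z. - z) ` K)" "bounded ((\<lambda>z. c) ` K)" for c :: complex
    using K by (auto simp: image_constant_conv)
  have lq: "uniform_limit K q Q sequentially" using assms by (rule uniform_limit_q)
  have const: "uniform_limit K (\<lambda>n z. complex_of_real (f n)) (\<lambda>_. complex_of_real l) sequentially"
    if "f \<longlonglongrightarrow> l" for f l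
    using that by (intro uniform_limit_by_bound[where g = "\<lambda>n. \<bar>f n - l\<bar>"])
       (auto simp: tendsto_rabs_zero_iff LIM_zero_iff norm_of_real simp flip: of_real_diff)
  define a where "a = (\<lambda>n z. complex_of_real (W n / W (Suc n) * \<kappa> n) *
      ((of_nat n + - of_real \<alpha>) / (of_nat n + - z) * ((of_nat n + 1) / (of_nat n + 0))))"
  define b where "b = (\<lambda>n z. (of_nat n + 1) / (of_nat n + 0) * (of_nat n * (q (Suc n) z - q n z))
       + (of_nat n + 1) / (of_nat n + - z) * (q n z * ((of_real \<alpha> - z) + of_real ((real n - \<alpha>) * (1 - \<kappa> n)))))"
  have "(\<lambda>n. W n / W (Suc n) * \<kappa> n) \<longlonglongrightarrow> \<mu> * 1"
    by (intro tendsto_mult W_ratio_limit kappa_limit)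
  then have "uniform_limit K a (\<lambda>_. of_real (\<mu> * 1) * (1 * 1)) sequentially"
    unfolding a_def by (intro uniform_lim_mult const uniform_limit_ratio_shift bd)
  then have a: "uniform_limit K a (\<lambda>_. of_real \<mu>) sequentially" by simp
  have bQ: "bounded ((\<lambda>z. Q z * ((of_real \<alpha> - z) + of_real 0)) ` K)" "bounded ((\<lambda>z. (of_real \<alpha> - z) + of_real 0) ` K)"
    by (intro compact_imp_bounded compact_continuous_image continuous_intros continuous_on_Q assms)+
  have "uniform_limit K b (\<lambda>z. 1 * 0 + 1 * (Q z * ((of_real \<alpha> - z) + of_real 0))) sequentially"
    unfolding b_def
    by (intro uniform_limit_add uniform_lim_mult[where l = "\<lambda>_. 1"] uniform_lim_mult[where l = Q]
          uniform_limit_const uniform_limit_ratio_shift uniform_limit_scaled_q_diff const kappa_defect_limit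
          bd bQ bounded_Q lq assms)
  then have b: "uniform_limit K b (\<lambda>z. Q z * (of_real \<alpha> - z)) sequentially" by simp
  show ?thesis
  proof (rule uniform_limit_affine_recurrence[OF a _ b])
    show "norm (complex_of_real \<mu>) < 1" using mu_pos mu_less_1 by simp
    show "bounded ((\<lambda>z. Q z * (of_real \<alpha> - z)) ` K)" using bQ(1) by simp
    show "\<forall>\<^sub>F n in sequentially. \<forall>z\<in>K. T (Suc n) z = a n z * T n z + b n z"
      using eventually_D_nonzero of_nat_minus_nonzero_eventually[OF K] eventually_gt_at_top[of 0]
    proof eventually_elim
      case (elim n)
      then show ?case
        unfolding a_def b_def by (auto simp: T_rec simp del: of_real_mult)
    qed
    have "bounded (T n ` K)" for n
      unfolding T_def
      by (intro compact_imp_bounded compact_continuous_image continuous_intros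
            continuous_on_compose2[OF continuous_on_rGamma[of UNIV]] assms) auto
    then show "\<forall>\<^sub>F n in sequentially. bounded (T n ` K)" by simp
  qed
qed

end

theorem theorem4p10:
  fixes \<gamma> \<mu> \<alpha> lam :: real and j :: nat and S :: "nat \<Rightarrow> real poly" and K :: "complex set"
  assumes "\<gamma> > 0" and "0 < \<mu>" and "\<mu> < 1" and "\<alpha> < 0" and "lam > 0" and "j \<ge> 1"
    and "monic_meixner_sobolev \<gamma> \<mu> \<alpha> lam j S"
    and "compact K"
  shows "uniform_limit K
    (\<lambda>n z. (of_real \<mu> - 1) ^ n * of_nat n * rGamma (of_nat n - z)
             * poly (map_poly complex_of_real (S n)) z)
    (\<lambda>z. - ((z - of_real \<alpha>) / of_real (1 - \<mu>) powr (of_real \<gamma> + z + 1) * rGamma (- z)))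
    sequentially"
proof -
  interpret meixner_sobolev \<gamma> \<mu> \<alpha> lam j S
    by unfold_locales (use assms in auto)
  have "Q z * (of_real \<alpha> - z) / (1 - of_real \<mu>)
      = - ((z - of_real \<alpha>) / of_real (1 - \<mu>) powr (of_real \<gamma> + z + 1) * rGamma (- z))" for z
  proof -
    let ?c = "complex_of_real (1 - \<mu>)"
    have c: "?c \<noteq> 0" using \<open>\<mu> < 1\<close> by simp
    have "?c powr (of_real \<gamma> + z + 1) = ?c powr (z + of_real \<gamma>) * ?c"
      using c by (simp add: powr_add add.commute del: of_real_diff)
    moreover have "?c powr (- (z + of_real \<gamma>)) = 1 / ?c powr (z + of_real \<gamma>)"
      by (simp only: powr_minus_divide)
    moreover have "1 - complex_of_real \<mu> = ?c" by simp
    moreover have "1 / P * g * (a - z) / c = - ((z - a) / (P * c) * g)" for P g a c :: complex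
      by (simp add: algebra_simps diff_divide_distrib)
    ultimately show ?thesis
      unfolding Q_def by (simp only:)
  qed
  with uniform_limit_T[OF \<open>compact K\<close>] show ?thesis
    unfolding T_def by simp
qed

end
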